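(* Let $A,\hat A\in\mathbb{C}^{n\times n}$ be positive-semidefinite matrices with Kaporin condition number $\kappa_{\rm Kap}$, and let $b,x_0\in\mathbb{C}^n$. Let $x_\star=A^+b$ be the minimum-norm solution to $\min_x\lVert Ax-b\rVert^2$, and assume $\lVert x_0-x_\star\rVert_A\ne0$. Then at each iteration $t\ge0$, the iterates $x_t$ produced by preconditioned conjugate gradient with preconditioner $\hat A$ and initial guess $x_0$ satisfy $$\frac{\lVert x_t-x_\star\rVert_A^2}{\lVert x_0-x_\star\rVert_A^2}\le\left[\frac{3\log(\kappa_{\rm Kap})}{t}\right]^t,$$ where the right-hand side is interpreted as $1$ when $t=0$.
   Context: Positive-semidefinite matrices are Hermitian; $M^+$ is the Moore–Penrose pseudoinverse, and $\lVert x\rVert_A=(x^*Ax)^{1/2}$. $\operatorname{vol}(M)$ is the product of the positive eigenvalues of $M$ (with multiplicity). Kaporin condition number: if $A$ and $\hat A$ have the same range and $r=\operatorname{rank}(A)$, $$\kappa_{\rm Kap}=\frac{\bigl(\frac1r\operatorname{tr}(A\hat A^+)\bigr)^r}{\operatorname{vol}(A\hat A^+)};$$ if $A$ and $\hat A$ have different ranges, $\kappa_{\rm Kap}=\infty$ (and then the bound is vacuous for $t\ge1$). Preconditioned conjugate gradient (PCG): starting from $x_0$, set $r_0=b-Ax_0$ and $d_1=\hat A^+r_0$. For $t=1,2,\ldots$, $$x_t=x_{t-1}+\alpha_td_t,\qquad r_t=r_{t-1}-\alpha_tAd_t,$$ $$\alpha_t=\frac{r_{t-1}^*\hat A^+r_{t-1}}{d_t^*Ad_t},\qquad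 d_{t+1}=\hat A^+r_t+\frac{r_t^*\hat A^+r_t}{r_{t-1}^*\hat A^+r_{t-1}}d_t.$$ If $\hat A^+r_{t}=0$ at some step $t$, the method has terminated and all later iterates equal $x_t$. *)

theory Defs
  imports
    "Jordan_Normal_Form.Schur_Decomposition"
    "Jordan_Normal_Form.DL_Rank"
    "HOL-Library.Extended_Real"
    Complex_Main
begin

text \<open>Throughout, \<open>v \<bullet>c w\<close> conjugates its \<^emph>\<open>second\<close> argument, so the inner product
  usually written \<open>x\<^sup>* y\<close> is \<open>y \<bullet>c x\<close>, and \<open>x\<^sup>* M x\<close> is \<open>(M *\<^sub>v x) \<bullet>c x\<close>.\<close>

text \<open>The order on \<^typ>\<open>complex\<close> satisfies \<open>0 \<le> z\<close> iff \<open>z\<close> is real and nonnegative.\<close>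

definition psd_mat :: "nat \<Rightarrow> complex mat \<Rightarrow> bool" where
  "psd_mat n A \<longleftrightarrow> A \<in> carrier_mat n n \<and> mat_adjoint A = A \<and>
     (\<forall>x \<in> carrier_vec n. 0 \<le> (A *\<^sub>v x) \<bullet>c x)"

text \<open>The four Penrose equations characterise the Moore--Penrose pseudoinverse.\<close>

definition is_pinv :: "complex mat \<Rightarrow> complex mat \<Rightarrow> bool" where
  "is_pinv M X \<longleftrightarrow> X \<in> carrier_mat (dim_col M) (dim_row M) \<and>
     M * X * M = M \<and> X * M * X = X \<and>
     mat_adjoint (M * X) = M * X \<and> mat_adjoint (X * M) = X * M"

definition pinv :: "complex mat \<Rightarrow> complex mat" where
  "pinv M = (THE X. is_pinv M X)"

lemma mat_adjoint_index:
  "i < dim_col M \<Longrightarrow> j < dim_row M \<Longrightarrow> mat_adjoint M $$ (i, j) = conjugate (M $$ (j, i))"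
  unfolding mat_adjoint_def by (simp add: mat_of_rows_index)

lemma mat_adjoint_mult:
  fixes M N :: "complex mat"
  assumes "M \<in> carrier_mat m k" and "N \<in> carrier_mat k n"
  shows "mat_adjoint (M * N) = mat_adjoint N * mat_adjoint M"
proof (rule eq_matI)
  have dims: "dim_row (mat_adjoint K) = dim_col K" "dim_col (mat_adjoint K) = dim_row K"
    for K :: "complex mat"
    by (simp_all add: mat_adjoint_def)
  show "dim_row (mat_adjoint (M * N)) = dim_row (mat_adjoint N * mat_adjoint M)"
    and "dim_col (mat_adjoint (M * N)) = dim_col (mat_adjoint N * mat_adjoint M)"
    by (simp_all add: dims)
  fix i j
  assume "i < dim_row (mat_adjoint N * mat_adjoint M)"
    and "j < dim_col (mat_adjoint N * mat_adjoint M)"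
  then have ij: "i < dim_col N" "j < dim_row M" by (simp_all add: dims)
  then show "mat_adjoint (M * N) $$ (i, j) = (mat_adjoint N * mat_adjoint M) $$ (i, j)"
    using assms by (simp add: mat_adjoint_index dims scalar_prod_def mult.commute)
qed

lemma is_pinv_unique:
  assumes X: "is_pinv M X" and Y: "is_pinv M Y"
  shows "X = Y"
proof -
  let ?m = "dim_row M" and ?n = "dim_col M"
  have cM: "M \<in> carrier_mat ?m ?n" by simp
  have cX: "X \<in> carrier_mat ?n ?m" and cY: "Y \<in> carrier_mat ?n ?m"
    using X Y by (auto simp: is_pinv_def)
  note assoc = assoc_mult_mat
  have cMX: "M * X \<in> carrier_mat ?m ?m" and cMY: "M * Y \<in> carrier_mat ?m ?m"
    and cXM: "X * M \<in> carrier_mat ?n ?n" and cYM: "Y * M \<in> carrier_mat ?n ?n"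
    using cM cX cY by auto
  have "(M * X) * (M * Y) = (M * X * M) * Y"
    using assoc[OF cMX cM cY] by simp
  also have "\<dots> = M * Y" using X by (simp add: is_pinv_def)
  finally have 1: "(M * X) * (M * Y) = M * Y" .
  have "(M * Y) * (M * X) = (M * Y * M) * X"
    using assoc[OF cMY cM cX] by simp
  also have "\<dots> = M * X" using Y by (simp add: is_pinv_def)
  finally have 2: "(M * Y) * (M * X) = M * X" .
  have MXY: "M * X = M * Y"
    using mat_adjoint_mult[OF cMX cMY] 1 2 X Y by (simp add: is_pinv_def)
  have "(X * M) * (Y * M) = X * (M * (Y * M))"
    using assoc[OF cX cM cYM] by simp
  also have "M * (Y * M) = M" using assoc[OF cM cY cM] Y by (simp add: is_pinv_def)
  finally have 3: "(X * M) * (Y * M) = X * M" .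
  have "(Y * M) * (X * M) = Y * (M * (X * M))"
    using assoc[OF cY cM cXM] by simp
  also have "M * (X * M) = M" using assoc[OF cM cX cM] X by (simp add: is_pinv_def)
  finally have 4: "(Y * M) * (X * M) = Y * M" .
  have XYM: "X * M = Y * M"
    using mat_adjoint_mult[OF cXM cYM] 3 4 X Y by (simp add: is_pinv_def)
  have "X = (X * M) * X" using X by (simp add: is_pinv_def)
  also have "\<dots> = Y * (M * X)" using XYM assoc[OF cY cM cX] by simp
  also have "\<dots> = Y * M * Y" using MXY assoc[OF cY cM cY] by simp
  also have "\<dots> = Y" using Y by (simp add: is_pinv_def)
  finally show ?thesis .
qed

lemma pinv_eqI: "is_pinv M X \<Longrightarrow> pinv M = X"
  unfolding pinv_def using is_pinv_unique by blast

definition mat_trace :: "'a :: comm_monoid_add mat \<Rightarrow> 'a" where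
  "mat_trace M = (\<Sum>i < dim_row M. M $$ (i, i))"

text \<open>Eigenvalues are counted with algebraic multiplicity; the matrix need not be Hermitian.\<close>

definition mat_vol :: "complex mat \<Rightarrow> real" where
  "mat_vol M = (\<Prod>l | 0 < l \<and> eigenvalue M (complex_of_real l).
      l ^ order (complex_of_real l) (char_poly M))"

text \<open>The trace of a product of two positive-semidefinite matrices is real, so taking the
  real part loses nothing where this is used.\<close>

definition kaporin :: "complex mat \<Rightarrow> complex mat \<Rightarrow> ereal" where
  "kaporin A Ah = (let n = dim_row A; r = vec_space.rank n A in
     if vec_space.col_space n A = vec_space.col_space n Ah
     then ereal ((1 / real r * Re (mat_trace (A * pinv Ah))) ^ r / mat_vol (A * pinv Ah))
     else \<infinity>)"

text \<open>Natural logarithm extended by \<open>log \<infinity> = \<infinity>\<close>; only arguments \<open>\<ge> 1\<close> matter.\<close>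

definition ln_ext :: "ereal \<Rightarrow> ereal" where
  "ln_ext x = (if x = \<infinity> then \<infinity> else ereal (ln (real_of_ereal x)))"

text \<open>For positive-semidefinite \<open>A\<close> the quantity under the root is real and nonnegative.\<close>

definition energy_norm :: "complex mat \<Rightarrow> complex vec \<Rightarrow> real" where
  "energy_norm A x = sqrt (Re ((A *\<^sub>v x) \<bullet>c x))"

text \<open>The state after \<open>t\<close> iterations is \<open>(x\<^sub>t, r\<^sub>t, d\<^sub>t\<^sub>+\<^sub>1)\<close>. Once \<open>pinv Ah *\<^sub>v r\<^sub>t = 0\<close> the method
  has terminated and the state stays constant.\<close>

fun pcg_step :: "complex mat \<Rightarrow> complex mat \<Rightarrow>
    complex vec \<times> complex vec \<times> complex vec \<Rightarrow> complex vec \<times> complex vec \<times> complex vec" where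
  "pcg_step A Ah (x, r, d) =
    (if pinv Ah *\<^sub>v r = 0\<^sub>v (dim_row A) then (x, r, d)
     else let
       \<alpha> = ((pinv Ah *\<^sub>v r) \<bullet>c r) / ((A *\<^sub>v d) \<bullet>c d);
       x' = x + \<alpha> \<cdot>\<^sub>v d;
       r' = r - \<alpha> \<cdot>\<^sub>v (A *\<^sub>v d);
       \<beta> = ((pinv Ah *\<^sub>v r') \<bullet>c r') / ((pinv Ah *\<^sub>v r) \<bullet>c r);
       d' = pinv Ah *\<^sub>v r' + \<beta> \<cdot>\<^sub>v d
     in (x', r', d'))"

primrec pcg_state :: "complex mat \<Rightarrow> complex mat \<Rightarrow> complex vec \<Rightarrow> complex vec \<Rightarrow> nat \<Rightarrow>
    complex vec \<times> complex vec \<times> complex vec" where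
  "pcg_state A Ah b x0 0 = (let r0 = b - A *\<^sub>v x0 in (x0, r0, pinv Ah *\<^sub>v r0))"
| "pcg_state A Ah b x0 (Suc t) = pcg_step A Ah (pcg_state A Ah b x0 t)"

definition pcg_iterate ::
    "complex mat \<Rightarrow> complex mat \<Rightarrow> complex vec \<Rightarrow> complex vec \<Rightarrow> nat \<Rightarrow> complex vec" where
  "pcg_iterate A Ah b x0 t = fst (pcg_state A Ah b x0 t)"

end

theory Submission
  imports Defs
begin

text \<open>Why the bound holds. When \<open>A\<close> and \<open>Ah\<close> have different ranges the right-hand side is infinite, or \<open>1\<close> for
  \<open>t = 0\<close>. Otherwise the two matrices are diagonalised simultaneously
  (\<open>psd_pair_simultaneous_diagonalization\<close>): there is an invertible \<open>V\<close> with
  \<open>A = V diag(l) V\<^sup>*\<close> and \<open>Ah\<^sup>+ = V\<^sup>-\<^sup>* J V\<^sup>-\<^sup>1\<close>, where \<open>J\<close> is the indicator of the positive \<open>l i\<close>. Then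
  \<open>A Ah\<^sup>+\<close> is similar to \<open>diag(l)\<close>, so the Kaporin condition number is a function of the positive
  \<open>l i\<close>: its logarithm \<open>K\<close> is the sum of \<open>l i / c - 1 - ln (l i / c)\<close>, with \<open>c\<close> the mean of the positive
  \<open>l i\<close> (\<open>ln_kaporin_eq_defect_sum\<close>).

  In the same coordinates preconditioned conjugate gradient is conjugate gradient for a diagonal matrix
  (\<open>pcg_state_diagonal_coordinates\<close>), and its residuals are orthogonal polynomials applied to the initial
  residual. Hence the energy norm of the error after \<open>t\<close> steps is at most that obtained from any
  polynomial \<open>p\<close> of degree at most \<open>t\<close> with \<open>p(0) = 1\<close> (\<open>cg_polys_optimal\<close>), and the ratio in the theorem is
  at most the maximum of \<open>p(l i)\<^sup>2\<close> over the positive \<open>l i\<close>.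

  It remains to choose \<open>p\<close> (\<open>residual_poly_linear_bound\<close>). Give \<open>p\<close> the smallest and the largest
  remaining eigenvalue as roots, again and again. Each such pair \<open>a \<le> b\<close> costs a factor of at most
  \<open>exp u - 1\<close>, where \<open>exp u = (a + b)\<^sup>2 / (4 a b)\<close>, and the exponents \<open>u\<close> of all the pairs add up to at
  most \<open>K\<close>. Concavity of \<open>ln (exp u - 1)\<close> distributes \<open>K\<close> evenly and gives
  \<open>p(l i)\<^sup>2 \<le> (exp (2 K / t) - 1)\<^sup>t\<close>, which is at most \<open>(3 K / t)\<^sup>t\<close> whenever the latter is below \<open>1\<close>.\<close>

section \<open>Residual polynomials\<close>

text \<open>Convexity of \<open>exp\<close>, obtained by averaging the tangent inequalities at \<open>s * w\<close> with weights \<open>s\<close>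
  and \<open>1 - s\<close>.\<close>

lemma exp_chord:
  fixes s w :: real
  assumes "0 \<le> s" "s \<le> 1"
  shows "exp (s * w) \<le> 1 - s + s * exp w"
proof -
  have "exp (s * w) * (1 + (w - s * w)) \<le> exp (s * w) * exp (w - s * w)"
    by (intro mult_left_mono exp_ge_add_one_self) auto
  then have 1: "exp (s * w) * (1 + (w - s * w)) \<le> exp w"
    by (simp add: exp_add[symmetric])
  have "exp (s * w) * (1 + (- (s * w))) \<le> exp (s * w) * exp (- (s * w))"
    by (intro mult_left_mono exp_ge_add_one_self) auto
  then have 2: "exp (s * w) * (1 - s * w) \<le> 1"
    by (simp add: exp_add[symmetric])
  have "s * (exp (s * w) * (1 + (w - s * w))) + (1 - s) * (exp (s * w) * (1 - s * w))
    \<le> s * exp w + (1 - s) * 1"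
    using assms 1 2 by (intro add_mono mult_left_mono) auto
  then show ?thesis by (simp add: algebra_simps)
qed

text \<open>The logarithm of \<open>exp z - 1\<close> is concave in \<open>z\<close>, with slope \<open>exp m / (exp m - 1)\<close> at \<open>m\<close>.
  This is its tangent inequality at \<open>m\<close> in exponentiated form, which stays valid where the logarithm
  is undefined.\<close>

lemma exp_minus_one_tangent:
  fixes m z :: real
  assumes m: "m > 0"
  shows "exp z - 1 \<le> (exp m - 1) * exp (exp m / (exp m - 1) * (z - m))"
proof -
  define q where "q = exp m"
  have q: "q > 1" using m by (simp add: q_def)
  have eq: "(q - 1) / q * (q / (q - 1) * (z - m)) = z - m" using q by simp
  have "exp (z - m) \<le> 1 - (q - 1) / q + (q - 1) / q * exp (q / (q - 1) * (z - m))"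
    using exp_chord[of "(q - 1) / q" "q / (q - 1) * (z - m)"] q unfolding eq by simp
  then have "q * exp (z - m) \<le> q * (1 - (q - 1) / q + (q - 1) / q * exp (q / (q - 1) * (z - m)))"
    using q by (intro mult_left_mono) auto
  also have "\<dots> = 1 + (q - 1) * exp (q / (q - 1) * (z - m))"
    using q by (simp add: field_simps)
  also have "q * exp (z - m) = exp z" by (simp add: q_def exp_add[symmetric])
  finally show ?thesis by (simp add: q_def)
qed

text \<open>Jensen's inequality for the concave function \<open>ln (exp z - 1)\<close>, with weight \<open>2\<close> at \<open>x\<close> and
  weight \<open>t\<close> at \<open>y\<close>: when the tangent inequalities at the weighted mean of \<open>x\<close> and \<open>y\<close>
  are multiplied, the exponential factors cancel.\<close>

lemma exp_minus_one_weighted_geometric_mean: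
  fixes x y :: real
  assumes x: "0 \<le> x" and y: "0 \<le> y"
  shows "(exp x - 1)\<^sup>2 * (exp y - 1) ^ t
    \<le> (exp ((2 * x + real t * y) / (real t + 2)) - 1) ^ (t + 2)"
proof -
  define m where "m = (2 * x + real t * y) / (real t + 2)"
  have m0: "0 \<le> m" using x y by (simp add: m_def)
  show ?thesis
  proof (cases "m = 0")
    case True
    have "2 * x + real t * y = 0" using True by (simp add: m_def)
    then have "x = 0" using x y mult_nonneg_nonneg[of "real t" y] by linarith
    then show ?thesis using m0 by (simp add: m_def)
  next
    case False
    then have m: "m > 0" using m0 by simp
    define k where "k = exp m / (exp m - 1)"
    have "(exp x - 1)\<^sup>2 * (exp y - 1) ^ t
      \<le> ((exp m - 1) * exp (k * (x - m)))\<^sup>2 * ((exp m - 1) * exp (k * (y - m))) ^ t"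
      using exp_minus_one_tangent[OF m] x y m unfolding k_def
      by (intro mult_mono power_mono) auto
    also have "\<dots> = (exp m - 1) ^ (t + 2) * (exp (k * (x - m)) ^ 2 * exp (k * (y - m)) ^ t)"
      by (simp add: power_mult_distrib power_add power2_eq_square)
    also have "exp (k * (x - m)) ^ 2 * exp (k * (y - m)) ^ t
      = exp (k * (2 * x + real t * y - (real t + 2) * m))"
      by (simp add: exp_of_nat_mult[symmetric] exp_add[symmetric] exp_double[symmetric]) (simp add: algebra_simps)
    also have "2 * x + real t * y - (real t + 2) * m = 0"
      by (simp add: m_def)
    finally show ?thesis by (simp add: m_def)
  qed
qed

text \<open>Nonnegative on the positive reals and zero only at \<open>1\<close>. Summed over positive eigenvalues divided by their
  arithmetic mean it gives the logarithm of the Kaporin condition number. Unlike that number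
  itself, the sum is additive over the spectrum, so eigenvalues can be split off one pair at a time.\<close>

definition kaporin_defect :: "real \<Rightarrow> real" where
  "kaporin_defect x = x - 1 - ln x"

lemma kaporin_defect_nonneg: "x > 0 \<Longrightarrow> kaporin_defect x \<ge> 0"
  using ln_le_minus_one[of x] by (simp add: kaporin_defect_def)

text \<open>The number \<open>u\<close> is the logarithm of the Kaporin condition number of the pair \<open>a, b\<close>. Scaling by the
  mean of the pair minimises the sum of the two defects, so any other scale \<open>c\<close> can only increase it.\<close>

lemma two_point_defect:
  fixes a b :: real
  assumes a: "a > 0" and b: "b > 0" and c: "c > 0"
  defines "u \<equiv> ln ((a + b)\<^sup>2 / (4 * a * b))"
  shows "0 \<le> u" and "u \<le> kaporin_defect (a / c) + kaporin_defect (b / c)"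
    and "exp u = (a + b)\<^sup>2 / (4 * a * b)"
proof -
  have ge: "(a + b)\<^sup>2 / (4 * a * b) \<ge> 1"
    using a b sum_squares_ge_zero[of "a - b" 0]
    by (simp add: field_simps power2_eq_square)
  show "0 \<le> u" "exp u = (a + b)\<^sup>2 / (4 * a * b)" using ge a b by (auto simp: u_def)
  have "ln ((a + b) / (2 * c)) \<le> (a + b) / (2 * c) - 1"
    using a b c by (intro ln_le_minus_one) auto
  moreover have "u = 2 * ln ((a + b) / (2 * c)) - ln (a / c) - ln (b / c)"
  proof -
    have "ln (4::real) = 2 * ln 2" using ln_realpow[of 2 2] by simp
    then show ?thesis using a b c by (simp add: u_def ln_div ln_mult ln_realpow)
  qed
  ultimately show "u \<le> kaporin_defect (a / c) + kaporin_defect (b / c)"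
    using c by (simp add: kaporin_defect_def add_divide_distrib)
qed

text \<open>Induction on \<open>t\<close> in steps of two. A quadratic factor with roots at the smallest eigenvalue \<open>a\<close> and
  the largest eigenvalue \<open>b\<close> removes both, and between them it is at most
  \<open>(b - a)\<^sup>2 / (4 a b) = exp u - 1\<close> in absolute value, where \<open>u\<close> is at most the pair's share of the
  total defect. The remaining eigenvalues are handled by the induction hypothesis with \<open>t - 2\<close>, and
  Jensen's inequality recombines the two factors. For odd \<open>t\<close> the induction ends with a linear factor
  that has its root at the midpoint of the remaining spectrum.

  For \<open>t = 0\<close> the bound reads \<open>0 ^ 0 = 1\<close>.\<close>

lemma residual_poly_exp_bound:
  fixes l :: "'i \<Rightarrow> real" and c :: real
  assumes "finite I" and "\<And>i. i \<in> I \<Longrightarrow> l i > 0" and c: "c > 0"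
  shows "\<exists>p. degree p \<le> t \<and> poly p 0 = 1 \<and>
    (\<forall>i\<in>I. (poly p (l i))\<^sup>2 \<le> (exp (2 * (\<Sum>i\<in>I. kaporin_defect (l i / c)) / real t) - 1) ^ t)"
  using assms(1,2)
proof (induction t arbitrary: I rule: induct_nat_012)
  case 0
  then show ?case by (intro exI[of _ 1]) auto
next
  case 1
  show ?case
  proof (cases "I = {}")
    case True
    then show ?thesis by (intro exI[of _ 1]) auto
  next
    case False
    define K where "K = (\<Sum>i\<in>I. kaporin_defect (l i / c))"
    obtain i j where i: "i \<in> I" "\<And>k. k \<in> I \<Longrightarrow> l i \<le> l k" and j: "j \<in> I" "\<And>k. k \<in> I \<Longrightarrow> l k \<le> l j"
      using arg_min_if_finite[OF 1(1) False, of l] arg_min_if_finite[OF 1(1) False, of "\<lambda>i. - l i"]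
      by (metis linorder_not_less neg_less_iff_less)
    let ?a = "l i" and ?b = "l j"
    have ab: "?a > 0" "?b > 0" using 1 i j by auto
    have defect: "kaporin_defect (l k / c) \<ge> 0" if "k \<in> I" for k
      using kaporin_defect_nonneg c 1(2)[OF that] by simp
    note u = two_point_defect[OF ab c]
    let ?u = "ln ((?a + ?b)\<^sup>2 / (4 * ?a * ?b))"
    have uK: "?u \<le> K"
    proof (cases "i = j")
      case True
      then show ?thesis using ab defect by (auto simp: K_def power2_eq_square intro!: sum_nonneg)
    next
      case False
      have "(\<Sum>k\<in>{i, j}. kaporin_defect (l k / c)) \<le> K"
        unfolding K_def using i j 1(1) defect by (intro sum_mono2) auto
      then show ?thesis using u(2) False by simp
    qed
    let ?p = "[:1, - 2 / (?a + ?b):]"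
    have "(poly ?p (l k))\<^sup>2 \<le> exp (2 * K) - 1" if k: "k \<in> I" for k
    proof -
      have "poly ?p (l k) = (?a + ?b - 2 * l k) / (?a + ?b)" using ab by (simp add: field_simps)
      moreover have "\<bar>?a + ?b - 2 * l k\<bar> \<le> ?b - ?a"
        using i(2)[OF k] j(2)[OF k] by (simp add: abs_le_iff)
      ultimately have "\<bar>poly ?p (l k)\<bar> \<le> (?b - ?a) / (?a + ?b)"
        using ab by (simp only: abs_divide) (simp add: divide_right_mono)
      then have "(poly ?p (l k))\<^sup>2 \<le> ((?b - ?a) / (?a + ?b))\<^sup>2"
        by (metis abs_ge_zero power2_abs power_mono)
      also have "\<dots> = 1 - exp (- ?u)"
        proof -
        have "(?a + ?b)\<^sup>2 \<noteq> 0" using ab by simp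
        then show ?thesis unfolding exp_minus u(3) power_divide
          by (simp add: divide_simps) (simp add: algebra_simps power2_eq_square)
      qed
      also have "\<dots> \<le> exp ?u - 1"
        using exp_ge_add_one_self[of "- ?u"] exp_ge_add_one_self[of "?u"] by linarith
      also have "\<dots> \<le> exp (2 * K) - 1" using u(1) uK by simp
      finally show ?thesis .
    qed
    then show ?thesis by (intro exI[of _ ?p]) (auto simp: K_def)
  qed
next
  case (ge2 t)
  define K where "K = (\<Sum>i\<in>I. kaporin_defect (l i / c))"
  have defect: "kaporin_defect (l k / c) \<ge> 0" if "k \<in> I" for k
    using kaporin_defect_nonneg c ge2.prems(2)[OF that] by simp
  have K0: "K \<ge> 0" using defect by (auto simp: K_def intro: sum_nonneg)
  have bound0: "0 \<le> (exp (2 * K / real (Suc (Suc t))) - 1) ^ Suc (Suc t)"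
    using K0 by (intro zero_le_power) auto
  show ?case
  proof (cases "I = {}")
    case True
    then show ?thesis by (intro exI[of _ 1]) auto
  next
    case False
    obtain i j where i: "i \<in> I" "\<And>k. k \<in> I \<Longrightarrow> l i \<le> l k" and j: "j \<in> I" "\<And>k. k \<in> I \<Longrightarrow> l k \<le> l j"
      using arg_min_if_finite[OF ge2.prems(1) False, of l]
        arg_min_if_finite[OF ge2.prems(1) False, of "\<lambda>i. - l i"]
      by (metis linorder_not_less neg_less_iff_less)
    let ?a = "l i" and ?b = "l j"
    have ab: "?a > 0" "?b > 0" using ge2.prems i j by auto
    show ?thesis
    proof (cases "i = j")
      case True
      have "poly [:1, - 1 / ?a:] (l k) = 0" if "k \<in> I" for k
        using i(2)[OF that] j(2)[OF that] True ab by (simp add: field_simps)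
      then have "(poly [:1, - 1 / ?a:] (l k))\<^sup>2 \<le> (exp (2 * K / real (Suc (Suc t))) - 1) ^ Suc (Suc t)"
        if "k \<in> I" for k using bound0 that by (simp only: zero_power2)
      then show ?thesis unfolding K_def
        by (intro exI[of _ "[:1, - 1 / ?a:]"] conjI ballI) simp_all
    next
      case False
      define J where "J = I - {i, j}"
      define K' where "K' = (\<Sum>i\<in>J. kaporin_defect (l i / c))"
      have K'0: "K' \<ge> 0" using defect by (auto simp: K'_def J_def intro: sum_nonneg)
      note u = two_point_defect[OF ab c]
      define u where "u = ln ((?a + ?b)\<^sup>2 / (4 * ?a * ?b))"
      have "K = K' + (\<Sum>k\<in>{i, j}. kaporin_defect (l k / c))"
        unfolding K_def K'_def J_def using ge2.prems(1) i j
        by (subst sum.subset_diff[of "{i, j}"]) auto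
      then have uK: "u + K' \<le> K" using u(2) False by (simp add: u_def)
      obtain p where p: "degree p \<le> t" "poly p 0 = 1"
        "\<And>k. k \<in> J \<Longrightarrow> (poly p (l k))\<^sup>2 \<le> (exp (2 * K' / real t) - 1) ^ t"
        using ge2.IH(1)[of J] ge2.prems by (auto simp: J_def K'_def)
      define q where "q = [:1, - 1 / ?a:] * [:1, - 1 / ?b:]"
      have dq: "degree (q * p) \<le> Suc (Suc t)"
      proof -
        have "degree q \<le> 1 + 1"
          unfolding q_def by (intro order_trans[OF degree_mult_le] add_mono) auto
        then show ?thesis using degree_mult_le[of q p] p(1) by linarith
      qed
      have "(poly (q * p) (l k))\<^sup>2 \<le> (exp (2 * K / real (Suc (Suc t))) - 1) ^ Suc (Suc t)"
        if k: "k \<in> I" for k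
      proof (cases "k \<in> J")
        case False
        then have "poly q (l k) = 0" using k ab by (auto simp: J_def q_def)
        then show ?thesis using bound0 by simp
      next
        case True
        let ?x = "l k"
        have q: "poly q ?x = - ((?x - ?a) * (?b - ?x) / (?a * ?b))"
          using ab by (simp add: q_def field_simps)
        have x: "?a \<le> ?x" "?x \<le> ?b" using i j k by auto
        have "4 * ((?x - ?a) * (?b - ?x)) \<le> (?b - ?a)\<^sup>2"
          using sum_squares_ge_zero[of "2 * ?x - ?a - ?b" 0]
          by (simp add: algebra_simps power2_eq_square)
        then have "(?x - ?a) * (?b - ?x) / (?a * ?b) \<le> ((?b - ?a)\<^sup>2 / 4) / (?a * ?b)"
          using ab by (intro divide_right_mono) auto
        also have "\<dots> = exp u - 1"
          unfolding u_def u(3) using ab by (simp add: field_simps power2_eq_square)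
        finally have "(?x - ?a) * (?b - ?x) / (?a * ?b) \<le> exp u - 1" .
        then have "\<bar>poly q ?x\<bar> \<le> exp u - 1"
          unfolding q using x ab by simp
        then have "(poly q ?x)\<^sup>2 \<le> (exp u - 1)\<^sup>2"
          by (metis abs_ge_zero power2_abs power_mono)
        then have "(poly (q * p) ?x)\<^sup>2 \<le> (exp u - 1)\<^sup>2 * (exp (2 * K' / real t) - 1) ^ t"
          using p(3)[OF True] by (simp add: power_mult_distrib mult_mono)
        also have "\<dots> \<le> (exp ((2 * u + real t * (2 * K' / real t)) / (real t + 2)) - 1) ^ (t + 2)"
          using u(1) K'0 by (intro exp_minus_one_weighted_geometric_mean) (auto simp: u_def)
        also have "\<dots> \<le> (exp (2 * K / real (Suc (Suc t))) - 1) ^ (t + 2)"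
        proof (rule power_mono)
          have "2 * u + real t * (2 * K' / real t) \<le> 2 * K" using uK K'0 by auto
          then have "(2 * u + real t * (2 * K' / real t)) / (real t + 2) \<le> 2 * K / (real t + 2)"
            by (intro divide_right_mono) auto
          moreover have "real (Suc (Suc t)) = real t + 2" by simp
          ultimately show "exp ((2 * u + real t * (2 * K' / real t)) / (real t + 2)) - 1
            \<le> exp (2 * K / real (Suc (Suc t))) - 1"
            by (simp only: exp_le_cancel_iff diff_right_mono)
          show "0 \<le> exp ((2 * u + real t * (2 * K' / real t)) / (real t + 2)) - 1"
            using u(1) K'0 by (auto simp: u_def)
        qed
        finally show ?thesis by simp
      qed
      moreover have "poly (q * p) 0 = 1" using p(2) by (simp add: q_def)
      ultimately show ?thesis using dq by (intro exI[of _ "q * p"]) (auto simp: K_def)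
    qed
  qed
qed

text \<open>If \<open>3 K / t \<ge> 1\<close>, the constant polynomial \<open>1\<close> suffices. Otherwise \<open>2 K / t\<close> lies in \<open>[0, 2/3]\<close>, where
  \<open>exp\<close> is below its chord, and \<open>exp (2/3) \<le> 2\<close> turns \<open>exp (2 K / t) - 1\<close> into \<open>3 K / t\<close>. This is
  where the constant \<open>3\<close> comes from.\<close>

lemma residual_poly_linear_bound:
  fixes l :: "'i \<Rightarrow> real" and c :: real
  assumes fin: "finite I" and pos: "\<And>i. i \<in> I \<Longrightarrow> l i > 0" and c: "c > 0"
  defines "K \<equiv> \<Sum>i\<in>I. kaporin_defect (l i / c)"
  shows "\<exists>p. degree p \<le> t \<and> poly p 0 = 1 \<and>
    (\<forall>i\<in>I. (poly p (l i))\<^sup>2 \<le> (3 * K / real t) ^ t)"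
proof (cases "t = 0 \<or> 3 * K / real t \<ge> 1")
  case True
  then show ?thesis by (intro exI[of _ 1]) (auto intro: one_le_power)
next
  case False
  then have t: "t > 0" and Kt: "3 * K / real t < 1" by auto
  have K0: "K \<ge> 0" using kaporin_defect_nonneg pos c by (auto simp: K_def intro!: sum_nonneg)
  define s where "s = 3 * K / real t"
  have s: "0 \<le> s" "s \<le> 1" using K0 Kt by (auto simp: s_def)
  have e2: "exp (2 / 3 :: real) \<le> 2"
  proof -
    \<comment> \<open>Since \<open>2/3 = 10/15\<close>, it suffices that \<open>1 - 1/15 \<le> exp (- 1/15)\<close> and \<open>(14/15)^10 \<ge> 1/2\<close>.\<close>
    have "(14 / 15 :: real) ^ 10 \<le> exp (- (1 / 15)) ^ 10"
      using exp_ge_add_one_self[of "- (1 / 15 :: real)"] by (intro power_mono) auto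
    also have "\<dots> = 1 / exp (2 / 3)"
      by (simp add: exp_of_nat_mult[symmetric] exp_minus field_simps)
    finally have "(14 / 15 :: real) ^ 10 * exp (2 / 3) \<le> 1" by (simp add: field_simps)
    moreover have "(1 / 2 :: real) \<le> (14 / 15) ^ 10" by (simp add: field_simps)
    then have "(1 / 2 :: real) * exp (2 / 3) \<le> (14 / 15) ^ 10 * exp (2 / 3)"
      by (intro mult_right_mono) auto
    ultimately show ?thesis by linarith
  qed
  have "exp (2 * K / real t) = exp (s * (2 / 3))" using t by (simp add: s_def field_simps)
  also have "\<dots> \<le> 1 - s + s * exp (2 / 3)" using s by (rule exp_chord)
  also have "\<dots> \<le> 1 - s + s * 2" using s e2 by (intro add_left_mono mult_left_mono) auto
  finally have "exp (2 * K / real t) - 1 \<le> s" by simp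
  then have "(exp (2 * K / real t) - 1) ^ t \<le> s ^ t"
    using K0 by (intro power_mono) auto
  moreover obtain p where "degree p \<le> t" "poly p 0 = 1"
    "\<And>i. i \<in> I \<Longrightarrow> (poly p (l i))\<^sup>2 \<le> (exp (2 * K / real t) - 1) ^ t"
    using residual_poly_exp_bound[where I = I and l = l and t = t, OF fin pos c] unfolding K_def by blast
  ultimately show ?thesis unfolding s_def[symmetric] using order_trans by (intro exI[of _ p]) blast
qed

section \<open>Conjugate gradient as orthogonal polynomials\<close>

text \<open>With \<open>l i\<close> the eigenvalues and \<open>w i\<close> the squared moduli of the coordinates of the initial residual
  \<open>r\<^sub>0\<close>, this is the inner product of \<open>p(M) r\<^sub>0\<close> and \<open>q(M) r\<^sub>0\<close> for a diagonal matrix \<open>M\<close> of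
  eigenvalues, and so it expresses every scalar that conjugate gradient computes.\<close>

definition nodal_ip :: "'i set \<Rightarrow> ('i \<Rightarrow> real) \<Rightarrow> ('i \<Rightarrow> real) \<Rightarrow> real poly \<Rightarrow> real poly \<Rightarrow> real" where
  "nodal_ip I w l p q = (\<Sum>i\<in>I. w i * poly p (l i) * poly q (l i))"

lemma nodal_ip_linear:
  "nodal_ip I w l (p + p') q = nodal_ip I w l p q + nodal_ip I w l p' q"
  "nodal_ip I w l (p - p') q = nodal_ip I w l p q - nodal_ip I w l p' q"
  "nodal_ip I w l (smult a p) q = a * nodal_ip I w l p q"
  "nodal_ip I w l p (q + q') = nodal_ip I w l p q + nodal_ip I w l p q'"
  "nodal_ip I w l p (q - q') = nodal_ip I w l p q - nodal_ip I w l p q'"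
  "nodal_ip I w l p (smult a q) = a * nodal_ip I w l p q"
  "nodal_ip I w l 0 q = 0" "nodal_ip I w l p 0 = 0"
  by (simp_all add: nodal_ip_def algebra_simps sum.distrib sum_subtractf sum_distrib_left)

lemma nodal_ip_pCons_shift:
  "nodal_ip I w l (pCons 0 p) q = nodal_ip I w l p (pCons 0 q)"
  by (simp add: nodal_ip_def mult_ac)

text \<open>The conjugate gradient recurrence with the matrix replaced by the indeterminate: \<open>pCons 0 D\<close> is
  \<open>X * D\<close>, and \<open>R\<close> and \<open>D\<close> are the polynomials that produce the current residual and the next search
  direction from the initial residual. The stopping rule is that of the algorithm: the squared
  length of the residual is zero.\<close>

fun cg_polys :: "'i set \<Rightarrow> ('i \<Rightarrow> real) \<Rightarrow> ('i \<Rightarrow> real) \<Rightarrow> nat \<Rightarrow> real poly \<times> real poly" where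
  "cg_polys I w l 0 = (1, 1)"
| "cg_polys I w l (Suc t) = (let (R, D) = cg_polys I w l t in
    if nodal_ip I w l R R = 0 then (R, D)
    else let
      R' = R - smult (nodal_ip I w l R R / nodal_ip I w l (pCons 0 D) D) (pCons 0 D);
      D' = R' + smult (nodal_ip I w l R' R' / nodal_ip I w l R R) D
    in (R', D'))"

text \<open>The residual polynomials are orthogonal polynomials. The proof carries along that the directions
  are conjugate, that is, \<open>X * D\<close> is orthogonal to lower degrees, and that \<open>D\<close> has degree exactly \<open>t\<close>.
  The exact degree lets every polynomial of degree at most \<open>t\<close> be split into a multiple of \<open>D\<close> and
  a polynomial of lower degree, so orthogonality at the next step needs to be tested on these two only.\<close>

lemma cg_polys_orthogonal:
  fixes w l :: "'i \<Rightarrow> real"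
  assumes fin: "finite I" and w: "\<And>i. i \<in> I \<Longrightarrow> w i \<ge> 0" and l: "\<And>i. i \<in> I \<Longrightarrow> l i > 0"
    and RD: "cg_polys I w l t = (R, D)" and R0: "nodal_ip I w l R R \<noteq> 0"
  shows "poly R 0 = 1" and "degree R \<le> t"
    and "\<And>q. degree q < t \<Longrightarrow> nodal_ip I w l R q = 0"
proof -
  let ?ip = "nodal_ip I w l"
  define good where "good t R D \<longleftrightarrow> poly R 0 = 1 \<and> degree R \<le> t \<and> degree D = t \<and> D \<noteq> 0 \<and>
    ?ip R D = ?ip R R \<and> (\<forall>q. degree q < t \<longrightarrow> ?ip R q = 0) \<and>
    (\<forall>q. degree q < t \<longrightarrow> ?ip (pCons 0 D) q = 0)" for t R D
  have pos: "?ip (pCons 0 D) D > 0" if g: "good t R D" and R0: "?ip R R \<noteq> 0" for t R D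
  proof -
    have "?ip R D \<noteq> 0" using g R0 by (simp add: good_def)
    then obtain i where i: "i \<in> I" "w i * poly R (l i) * poly D (l i) \<noteq> 0"
      unfolding nodal_ip_def by (meson sum.not_neutral_contains_not_neutral)
    have "0 < w i * (l i * poly D (l i)) * poly D (l i)"
    proof -
      have "0 < w i * l i * (poly D (l i))\<^sup>2"
        using i w[OF i(1)] l[OF i(1)] by (simp add: less_le)
      then show ?thesis by (simp add: power2_eq_square mult_ac)
    qed
    moreover have "0 \<le> w k * (l k * poly D (l k)) * poly D (l k)" if "k \<in> I" for k
    proof -
      have "0 \<le> w k * l k * (poly D (l k))\<^sup>2"
        using w[OF that] l[OF that] by simp
      then show ?thesis by (simp add: power2_eq_square mult_ac)
    qed
    ultimately show ?thesis unfolding nodal_ip_def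
      by (intro sum_pos2[OF fin i(1)]) auto
  qed
  have "?ip R R = 0 \<or> good t R D"
    using RD
  proof (induction t arbitrary: R D)
    case 0
    then show ?case by (auto simp: good_def)
  next
    case (Suc t R2 D2)
    obtain R D where RD: "cg_polys I w l t = (R, D)" by fastforce
    show ?case
    proof (cases "?ip R R = 0")
      case True
      then show ?thesis using Suc.prems RD by simp
    next
      case False
      then have g: "good t R D" using Suc.IH[OF RD] by simp
      define \<delta> where "\<delta> = ?ip (pCons 0 D) D"
      have \<delta>: "\<delta> > 0" using pos[OF g False] by (simp add: \<delta>_def)
      define \<alpha> where "\<alpha> = ?ip R R / \<delta>"
      have \<alpha>: "\<alpha> \<noteq> 0" using False \<delta> by (simp add: \<alpha>_def)
      have R2: "R2 = R - smult \<alpha> (pCons 0 D)"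
        using Suc.prems RD False by (auto simp: Let_def \<alpha>_def \<delta>_def)
      define \<beta> where "\<beta> = ?ip R2 R2 / ?ip R R"
      have D2: "D2 = R2 + smult \<beta> D"
        using Suc.prems RD False by (auto simp: Let_def \<beta>_def R2 \<alpha>_def \<delta>_def)
      have degD: "degree D = t" "D \<noteq> 0" and degR: "degree R \<le> t" and R1: "poly R 0 = 1"
        and RDR: "?ip R D = ?ip R R"
        and oR: "\<And>q. degree q < t \<Longrightarrow> ?ip R q = 0"
        and oD: "\<And>q. degree q < t \<Longrightarrow> ?ip (pCons 0 D) q = 0"
        using g by (auto simp: good_def)
      have split: "\<exists>c q'. q = smult c D + q' \<and> (q' = 0 \<or> degree q' < t)" if q: "degree q < Suc t" for q
      proof -
        define c where "c = coeff q t / coeff D t"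
        have "coeff D t \<noteq> 0" using degD by auto
        then have "coeff (q - smult c D) t = 0" by (simp add: c_def)
        moreover have "degree (q - smult c D) \<le> t" using q degD
          by (intro degree_diff_le) auto
        ultimately have "q - smult c D = 0 \<or> degree (q - smult c D) < t"
          by (metis le_neq_implies_less leading_coeff_0_iff)
        then show ?thesis by (intro exI[of _ c] exI[of _ "q - smult c D"]) auto
      qed
      have R2D: "?ip R2 D = 0"
        using \<delta> by (simp add: R2 nodal_ip_linear RDR \<alpha>_def \<delta>_def del: smult_pCons)
      have oR2: "?ip R2 q = 0" if q: "degree q < Suc t" for q
      proof -
        obtain c q' where *: "q = smult c D + q'" "q' = 0 \<or> degree q' < t"
          using split[OF q] by auto
        then have "?ip R2 q' = 0" using oR oD by (auto simp: R2 nodal_ip_linear simp del: smult_pCons)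
        then show ?thesis using R2D * by (simp add: nodal_ip_linear)
      qed
      \<comment> \<open>The update of the residual expresses \<open>X * D\<close> by two consecutive residuals, which are orthogonal.\<close>
      have R2XD: "?ip R2 (pCons 0 D) = - ?ip R2 R2 / \<alpha>"
      proof -
        have "pCons 0 D = smult (1 / \<alpha>) (R - R2)" using \<alpha> by (simp add: R2)
        then have "?ip R2 (pCons 0 D) = (?ip R2 R - ?ip R2 R2) / \<alpha>"
          by (simp add: nodal_ip_linear)
        then show ?thesis using oR2[of R] degR by simp
      qed
      have oD2: "?ip (pCons 0 D2) q = 0" if q: "degree q < Suc t" for q
      proof -
        have *: "?ip (pCons 0 D2) q = ?ip R2 (pCons 0 q) + \<beta> * ?ip (pCons 0 D) q" for q
        proof -
          have "pCons 0 D2 = pCons 0 R2 + smult \<beta> (pCons 0 D)" by (simp add: D2)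
          then show ?thesis by (simp add: nodal_ip_linear nodal_ip_pCons_shift)
        qed
        obtain c q' where q': "q = smult c D + q'" "q' = 0 \<or> degree q' < t"
          using split[OF q] by auto
        have "?ip (pCons 0 D2) q' = 0"
          using q'(2) oR2[of "pCons 0 q'"] oD[of q'] by (auto simp: * nodal_ip_linear)
        moreover have "?ip (pCons 0 D2) D = 0"
          using False \<delta> \<alpha> by (simp add: * R2XD \<beta>_def \<delta>_def[symmetric]) (simp add: \<alpha>_def)
        ultimately show ?thesis using q'(1) by (simp add: nodal_ip_linear)
      qed
      have dR2: "degree R2 = Suc t"
      proof -
        have "degree (smult \<alpha> (pCons 0 D)) = Suc t" using \<alpha> degD by (simp del: smult_pCons)
        then show ?thesis unfolding R2 using degR degree_add_eq_right[of R "- smult \<alpha> (pCons 0 D)"]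
          by (simp del: smult_pCons)
      qed
      have dD2: "degree D2 = Suc t"
        unfolding D2 using dR2 degD degree_smult_le[of \<beta> D]
        by (subst degree_add_eq_left) auto
      have "D2 \<noteq> 0" using dD2 by auto
      moreover have "?ip R2 D2 = ?ip R2 R2" by (simp add: D2 nodal_ip_linear R2D)
      moreover have "poly R2 0 = 1" using R1 by (simp add: R2)
      ultimately show ?thesis unfolding good_def using dR2 dD2 oR2 oD2 by auto
    qed
  qed
  then have "good t R D" using R0 by simp
  then show "poly R 0 = 1" "degree R \<le> t" "\<And>q. degree q < t \<Longrightarrow> ?ip R q = 0"
    by (auto simp: good_def)
qed

text \<open>If \<open>w\<close> comes from the initial residual, the left-hand side is the squared energy norm of the error.
  Any competitor is \<open>p = R + X * q\<close> with \<open>degree q < t\<close>, as both are \<open>1\<close> at \<open>0\<close>. Dividing by \<open>l i\<close>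
  turns the mixed term into the inner product of \<open>R\<close> and \<open>q\<close>, which is zero.\<close>

lemma cg_polys_optimal:
  fixes w l :: "'i \<Rightarrow> real"
  assumes fin: "finite I" and w: "\<And>i. i \<in> I \<Longrightarrow> w i \<ge> 0" and l: "\<And>i. i \<in> I \<Longrightarrow> l i > 0"
    and RD: "cg_polys I w l t = (R, D)" and p: "degree p \<le> t" "poly p 0 = 1"
  shows "(\<Sum>i\<in>I. w i * (poly R (l i))\<^sup>2 / l i) \<le> (\<Sum>i\<in>I. w i * (poly p (l i))\<^sup>2 / l i)"
proof (cases "nodal_ip I w l R R = 0")
  case True
  have "(\<Sum>i\<in>I. w i * (poly R (l i))\<^sup>2) = 0"
    using True by (simp add: nodal_ip_def power2_eq_square mult_ac)
  then have "w i * (poly R (l i))\<^sup>2 = 0" if "i \<in> I" for i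
    using that w fin by (subst (asm) sum_nonneg_eq_0_iff) auto
  then have "(\<Sum>i\<in>I. w i * (poly R (l i))\<^sup>2 / l i) = 0" by (intro sum.neutral) auto
  also have "\<dots> \<le> (\<Sum>i\<in>I. w i * (poly p (l i))\<^sup>2 / l i)"
    using w l by (intro sum_nonneg divide_nonneg_pos) auto
  finally show ?thesis .
next
  case False
  note orth_R = cg_polys_orthogonal[OF fin w l RD False]
  have "poly (p - R) 0 = 0" using p orth_R(1) by simp
  then obtain q where q: "p - R = pCons 0 q"
    by (metis pCons_cases poly_pCons mult_zero_left add_0_right)
  have "nodal_ip I w l R q = 0"
  proof (cases "q = 0")
    case False
    have "degree (p - R) \<le> t" using p orth_R(2) by (intro degree_diff_le) auto
    then have "degree q < t" using False by (simp add: q)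
    then show ?thesis using orth_R(3)[of q] by blast
  qed (simp add: nodal_ip_linear)
  then have orth: "(\<Sum>i\<in>I. w i * poly R (l i) * poly q (l i)) = 0"
    by (simp add: nodal_ip_def)
  have "(\<Sum>i\<in>I. w i * (poly p (l i))\<^sup>2 / l i)
    = (\<Sum>i\<in>I. w i * (poly R (l i))\<^sup>2 / l i + 2 * (w i * poly R (l i) * poly q (l i))
        + w i * l i * (poly q (l i))\<^sup>2)"
  proof (rule sum.cong[OF refl])
    fix i assume i: "i \<in> I"
    have "poly (p - R) (l i) = l i * poly q (l i)" by (simp add: q)
    then have pi: "poly p (l i) = poly R (l i) + l i * poly q (l i)" by simp
    show "w i * (poly p (l i))\<^sup>2 / l i = w i * (poly R (l i))\<^sup>2 / l i
      + 2 * (w i * poly R (l i) * poly q (l i)) + w i * l i * (poly q (l i))\<^sup>2"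
      unfolding pi using l[OF i] by (simp add: field_simps power2_eq_square)
  qed
  also have "\<dots> = (\<Sum>i\<in>I. w i * (poly R (l i))\<^sup>2 / l i)
    + (\<Sum>i\<in>I. w i * l i * (poly q (l i))\<^sup>2)"
    using orth by (simp add: sum.distrib sum_distrib_left[symmetric])
  finally show ?thesis
    using sum_nonneg[of I "\<lambda>i. w i * l i * (poly q (l i))\<^sup>2"] w l by (simp add: less_imp_le)
qed

section \<open>Unitary diagonalisation of Hermitian matrices\<close>

lemma mat_adjoint_dim [simp]:
  "dim_row (mat_adjoint M) = dim_col M" "dim_col (mat_adjoint M) = dim_row M"
  by (simp_all add: mat_adjoint_def)

lemma mat_adjoint_carrier [simp, intro]:
  "M \<in> carrier_mat m k \<Longrightarrow> mat_adjoint M \<in> carrier_mat k m"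
  by auto

lemma mat_adjoint_involution [simp]:
  fixes M :: "complex mat"
  shows "mat_adjoint (mat_adjoint M) = M"
  by (rule eq_matI) (simp_all add: mat_adjoint_index)

lemma mat_adjoint_one [simp]: "mat_adjoint (1\<^sub>m n :: complex mat) = 1\<^sub>m n"
  by (rule eq_matI) (auto simp: mat_adjoint_index)

lemma mat_adjoint_mat_diag [simp]:
  "mat_adjoint (mat_diag n f :: complex mat) = mat_diag n (\<lambda>i. cnj (f i))"
  by (rule eq_matI) (auto simp: mat_adjoint_index mat_diag_def)

lemma mat_adjoint_four_block_diag:
  fixes A D :: "complex mat"
  assumes "A \<in> carrier_mat k k" "D \<in> carrier_mat m m"
  shows "mat_adjoint (four_block_mat A (0\<^sub>m k m) (0\<^sub>m m k) D)
    = four_block_mat (mat_adjoint A) (0\<^sub>m k m) (0\<^sub>m m k) (mat_adjoint D)"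
  by (rule eq_matI) (use assms in \<open>auto simp: mat_adjoint_index\<close>)

lemma four_block_diag_mult:
  fixes A D :: "'a :: semiring_0 mat"
  assumes "A \<in> carrier_mat k k" "A' \<in> carrier_mat k k" "D \<in> carrier_mat m m" "D' \<in> carrier_mat m m"
  shows "four_block_mat A (0\<^sub>m k m) (0\<^sub>m m k) D * four_block_mat A' (0\<^sub>m k m) (0\<^sub>m m k) D'
    = four_block_mat (A * A') (0\<^sub>m k m) (0\<^sub>m m k) (D * D')"
proof -
  have "0\<^sub>m k m * D' = 0\<^sub>m k m" "0\<^sub>m m k * A' = 0\<^sub>m m k" "A * 0\<^sub>m k m = 0\<^sub>m k m" "D * 0\<^sub>m m k = 0\<^sub>m m k"
    using assms left_mult_zero_mat right_mult_zero_mat by blast+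
  then show ?thesis
    using assms by (subst mult_four_block_mat[of _ k k _ m _ m _ _ k _ m]) auto
qed

lemma mult_mat_vec_cscalar:
  fixes M :: "complex mat"
  assumes M: "M \<in> carrier_mat m k" and u: "u \<in> carrier_vec k" and v: "v \<in> carrier_vec m"
  shows "(M *\<^sub>v u) \<bullet>c v = u \<bullet>c (mat_adjoint M *\<^sub>v v)"
proof -
  have "(M *\<^sub>v u) \<bullet>c v = (\<Sum>i<m. \<Sum>j<k. M $$ (i, j) * u $ j * cnj (v $ i))"
    using M u v by (auto simp: scalar_prod_def sum_distrib_right atLeast0LessThan intro!: sum.cong)
  also have "\<dots> = (\<Sum>j<k. \<Sum>i<m. M $$ (i, j) * u $ j * cnj (v $ i))"
    by (rule sum.swap)
  also have "\<dots> = u \<bullet>c (mat_adjoint M *\<^sub>v v)"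
    using M u v by (auto simp: scalar_prod_def sum_distrib_left atLeast0LessThan mat_adjoint_index
        mult_ac intro!: sum.cong)
  finally show ?thesis .
qed

text \<open>Gram--Schmidt on a completion of \<open>v\<close> to a basis keeps \<open>v\<close> as its first vector but does not normalise,
  so the resulting columns are divided by their lengths.\<close>

lemma ex_unitary_with_first_col:
  fixes v :: "complex vec"
  assumes v: "v \<in> carrier_vec n" and v0: "v \<noteq> 0\<^sub>v n"
  shows "\<exists>U c. U \<in> carrier_mat n n \<and> mat_adjoint U * U = 1\<^sub>m n \<and> col U 0 = c \<cdot>\<^sub>v v"
proof -
  interpret cof_vec_space n "TYPE(complex)" .
  define bs where "bs = basis_completion v"
  define ws where "ws = gram_schmidt n bs"
  from basis_completion[OF v v0, folded bs_def]
  have dist: "distinct bs" and indep: "\<not> lin_dep (set bs)" and bs: "set bs \<subseteq> carrier_vec n"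
    and hd: "hd bs = v" and len: "length bs = n" by auto
  have n: "n > 0" using v v0 by (cases n) auto
  from hd len n obtain vs where bv: "bs = v # vs" by (cases bs) auto
  from gram_schmidt_result[OF bs dist indep refl, folded ws_def]
  have ws: "set ws \<subseteq> carrier_vec n" "corthogonal ws" "length ws = n" by (auto simp: len)
  from gram_schmidt_hd[OF v, of vs, folded bv] have hdws: "hd ws = v" unfolding ws_def .
  have wsi: "ws ! i \<in> carrier_vec n" if "i < n" for i using ws that by auto
  define N where "N i = sqrt (Re (ws ! i \<bullet>c ws ! i))" for i
  have sq: "of_real (N i) * of_real (N i) = ws ! i \<bullet>c ws ! i" and N0: "N i \<noteq> 0" if i: "i < n" for i
  proof -
    have nn: "ws ! i \<bullet>c ws ! i \<ge> 0" by auto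
    then have "Re (ws ! i \<bullet>c ws ! i) \<ge> 0" "Im (ws ! i \<bullet>c ws ! i) = 0"
      by (auto simp: less_eq_complex_def)
    then show *: "of_real (N i) * of_real (N i) = ws ! i \<bullet>c ws ! i"
      by (auto simp: N_def complex_eq_iff)
    have "ws ! i \<bullet>c ws ! i \<noteq> 0" using ws(2,3) i by (auto simp: corthogonal_def)
    with * show "N i \<noteq> 0" by auto
  qed
  define U where "U = mat n n (\<lambda>(k, i). ws ! i $ k / of_real (N i))"
  have U: "U \<in> carrier_mat n n" by (simp add: U_def)
  have "mat_adjoint U * U = 1\<^sub>m n"
  proof (rule eq_matI)
    fix i j assume "i < dim_row (1\<^sub>m n)" "j < dim_col (1\<^sub>m n)"
    then have ij: "i < n" "j < n" by auto
    have dw: "dim_vec (ws ! i) = n" "dim_vec (ws ! j) = n" using wsi ij by auto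
    have "(mat_adjoint U * U) $$ (i, j)
      = (\<Sum>k<n. cnj (ws ! i $ k) / of_real (N i) * (ws ! j $ k / of_real (N j)))"
      using ij U by (simp add: scalar_prod_def mat_adjoint_index U_def atLeast0LessThan)
    also have "\<dots> = (\<Sum>k<n. ws ! j $ k * cnj (ws ! i $ k)) / (of_real (N i) * of_real (N j))"
      by (simp add: sum_divide_distrib mult_ac)
    also have "(\<Sum>k<n. ws ! j $ k * cnj (ws ! i $ k)) = ws ! j \<bullet>c ws ! i"
      using dw by (simp add: scalar_prod_def atLeast0LessThan)
    also have "\<dots> / (of_real (N i) * of_real (N j)) = 1\<^sub>m n $$ (i, j)"
    proof (cases "i = j")
      case True
      then show ?thesis using N0[of i] ij by (simp add: sq[symmetric])
    next
      case False
      then have "ws ! j \<bullet>c ws ! i = 0" using ws(2,3) ij by (auto simp: corthogonal_def)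
      then show ?thesis using False ij by simp
    qed
    finally show "(mat_adjoint U * U) $$ (i, j) = 1\<^sub>m n $$ (i, j)" .
  qed (use U in auto)
  moreover have "col U 0 = (1 / of_real (N 0)) \<cdot>\<^sub>v v"
    using hdws ws(3) n v by (auto simp: U_def hd_conv_nth)
  ultimately show ?thesis using U by blast
qed

text \<open>Deflation: in a unitary basis that starts with an eigenvector, the first column of the matrix is a
  multiple of the first unit vector. Being Hermitian, the matrix is then block diagonal, and the
  induction hypothesis applies to the lower block.\<close>

lemma hermitian_unitary_diagonalization:
  fixes A :: "complex mat"
  assumes "A \<in> carrier_mat n n" and "mat_adjoint A = A"
  shows "\<exists>U l. U \<in> carrier_mat n n \<and> mat_adjoint U * U = 1\<^sub>m n
    \<and> A = U * mat_diag n (\<lambda>i. complex_of_real (l i)) * mat_adjoint U"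
  using assms
proof (induction n arbitrary: A)
  case 0
  then show ?case by (intro exI[of _ A] exI[of _ "\<lambda>_. 0"]) (auto intro!: eq_matI)
next
  case (Suc n)
  let ?N = "Suc n"
  note A = Suc.prems(1) and herm = Suc.prems(2)
  obtain as where cp: "char_poly A = (\<Prod>a\<leftarrow>as. [:- a, 1:])" and "length as = ?N"
    using char_poly_factorized[OF A] by blast
  then obtain e as' where "as = e # as'" by (cases as) auto
  then have "eigenvalue A e" using cp by (simp add: eigenvalue_root_char_poly[OF A])
  then obtain v where v: "v \<in> carrier_vec ?N" "v \<noteq> 0\<^sub>v ?N" "A *\<^sub>v v = e \<cdot>\<^sub>v v"
    using A by (auto simp: eigenvalue_def eigenvector_def)
  obtain W c where W: "W \<in> carrier_mat ?N ?N" and WW: "mat_adjoint W * W = 1\<^sub>m ?N"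
    and c: "col W 0 = c \<cdot>\<^sub>v v" using ex_unitary_with_first_col[OF v(1,2)] by blast
  have WW': "W * mat_adjoint W = 1\<^sub>m ?N"
    using mat_mult_left_right_inverse[OF _ W WW] W by auto
  note as = assoc_mult_mat[of _ ?N ?N _ ?N _ ?N]
  have mc[simp]: "X \<in> carrier_mat ?N ?N \<Longrightarrow> Y \<in> carrier_mat ?N ?N \<Longrightarrow> X * Y \<in> carrier_mat ?N ?N"
    for X Y :: "complex mat" by auto
  have adjm: "X \<in> carrier_mat ?N ?N \<Longrightarrow> Y \<in> carrier_mat ?N ?N \<Longrightarrow>
    mat_adjoint (X * Y) = mat_adjoint Y * mat_adjoint X" for X Y :: "complex mat"
    by (rule mat_adjoint_mult)
  define B where "B = mat_adjoint W * A * W"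
  have B: "B \<in> carrier_mat ?N ?N" using W A by (simp add: B_def)
  have Bh: "mat_adjoint B = B" using W A herm by (simp add: B_def adjm as)
  have AWB: "A = W * B * mat_adjoint W"
  proof -
    have "W * B * mat_adjoint W = (W * mat_adjoint W) * A * (W * mat_adjoint W)"
      using W A by (simp add: B_def as)
    then show ?thesis using A WW' by simp
  qed
  have "B = mat_adjoint W * (A * W)" using W A by (simp add: B_def as)
  then have "col B 0 = mat_adjoint W *\<^sub>v (A *\<^sub>v col W 0)"
    using col_mult2[OF mat_adjoint_carrier[OF W] mc[OF A W], of 0] col_mult2[OF A W, of 0]
    by (simp only: zero_less_Suc)
  also have "A *\<^sub>v col W 0 = e \<cdot>\<^sub>v col W 0"
    unfolding c mult_mat_vec[OF A v(1)] v(3) by (simp add: smult_smult_assoc mult.commute)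
  also have "mat_adjoint W *\<^sub>v (e \<cdot>\<^sub>v col W 0) = e \<cdot>\<^sub>v (mat_adjoint W *\<^sub>v col W 0)"
  proof (rule mult_mat_vec)
    show "mat_adjoint W \<in> carrier_mat ?N ?N" using W by simp
    show "col W 0 \<in> carrier_vec ?N" using W v(1) c by simp
  qed
  also have "mat_adjoint W *\<^sub>v col W 0 = col (mat_adjoint W * W) 0"
    using col_mult2[OF mat_adjoint_carrier[OF W] W, of 0] by (simp only: zero_less_Suc)
  finally have col0: "col B 0 = e \<cdot>\<^sub>v col (1\<^sub>m ?N) 0" by (simp add: WW)
  have B0: "B $$ (i, 0) = (if i = 0 then e else 0)" if "i < ?N" for i
    using arg_cong[OF col0, of "\<lambda>u. u $ i"] that B by (auto simp: one_mat_def)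
  have B0': "B $$ (0, i) = (if i = 0 then cnj e else 0)" if i: "i < ?N" for i
  proof -
    have "mat_adjoint B $$ (0, i) = cnj (B $$ (i, 0))"
      using B i by (subst mat_adjoint_index) auto
    then show ?thesis using B0[OF i] Bh by auto
  qed
  have e: "e = of_real (Re e)" using B0[of 0] B0'[of 0] by (auto simp: complex_eq_iff)
  have ce: "cnj e = e" using B0[of 0] B0'[of 0] by simp
  define C where "C = mat n n (\<lambda>(i, j). B $$ (Suc i, Suc j))"
  have C: "C \<in> carrier_mat n n" by (simp add: C_def)
  have Ch: "mat_adjoint C = C"
  proof (rule eq_matI)
    fix i j assume "i < dim_row C" "j < dim_col C"
    then have ij: "i < n" "j < n" using C by auto
    have "mat_adjoint B $$ (Suc i, Suc j) = cnj (B $$ (Suc j, Suc i))"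
      using B ij by (subst mat_adjoint_index) auto
    then show "mat_adjoint C $$ (i, j) = C $$ (i, j)"
      using ij Bh by (simp add: mat_adjoint_index C_def)
  qed (use C in auto)
  let ?E = "mat 1 1 (\<lambda>_. e)"
  have Bblock: "B = four_block_mat ?E (0\<^sub>m 1 n) (0\<^sub>m n 1) C"
    by (rule eq_matI) (use B B0 B0' in \<open>auto simp: C_def ce\<close>)
  obtain V l where V: "V \<in> carrier_mat n n" and VV: "mat_adjoint V * V = 1\<^sub>m n"
    and CV: "C = V * mat_diag n (\<lambda>i. complex_of_real (l i)) * mat_adjoint V"
    using Suc.IH[OF C Ch] by blast
  let ?V = "four_block_mat (1\<^sub>m 1) (0\<^sub>m 1 n) (0\<^sub>m n 1) V"
  let ?l = "\<lambda>i. case i of 0 \<Rightarrow> Re e | Suc j \<Rightarrow> l j"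
  let ?D = "mat_diag n (\<lambda>i. complex_of_real (l i))"
  let ?D' = "mat_diag ?N (\<lambda>i. complex_of_real (?l i))"
  have Dblock: "?D' = four_block_mat ?E (0\<^sub>m 1 n) (0\<^sub>m n 1) ?D"
    by (rule eq_matI) (auto simp: mat_diag_def e[symmetric] split: nat.splits)
  have V': "?V \<in> carrier_mat ?N ?N" using V by auto
  have adjV: "mat_adjoint ?V = four_block_mat (1\<^sub>m 1) (0\<^sub>m 1 n) (0\<^sub>m n 1) (mat_adjoint V)"
    using V by (simp add: mat_adjoint_four_block_diag)
  have VV': "mat_adjoint ?V * ?V = 1\<^sub>m ?N"
  proof -
    have "mat_adjoint ?V * ?V = four_block_mat (1\<^sub>m 1) (0\<^sub>m 1 n) (0\<^sub>m n 1) (1\<^sub>m n)"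
      unfolding adjV using V VV by (simp add: four_block_diag_mult)
    then show ?thesis by (simp add: four_block_one_mat)
  qed
  have BV: "B = ?V * ?D' * mat_adjoint ?V"
  proof -
    have 1: "?V * ?D' = four_block_mat ?E (0\<^sub>m 1 n) (0\<^sub>m n 1) (V * ?D)"
      unfolding Dblock using V by (simp add: four_block_diag_mult)
    have VD: "V * ?D \<in> carrier_mat n n" using V by auto
    show ?thesis unfolding 1 adjV Bblock using V VD CV by (simp add: four_block_diag_mult)
  qed
  then obtain X where X: "X \<in> carrier_mat ?N ?N" and XX: "mat_adjoint X * X = 1\<^sub>m ?N"
    and BX: "B = X * ?D' * mat_adjoint X" using V' VV' by blast
  have "mat_adjoint (W * X) * (W * X) = mat_adjoint X * ((mat_adjoint W * W) * X)"
    using W X by (simp only: adjm as mc mat_adjoint_carrier)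
  also have "\<dots> = 1\<^sub>m ?N" unfolding WW using XX by (simp add: left_mult_one_mat[OF X])
  finally have *: "mat_adjoint (W * X) * (W * X) = 1\<^sub>m ?N" .
  have "?D' \<in> carrier_mat ?N ?N" by simp
  then have "(W * X) * ?D' * mat_adjoint (W * X) = W * B * mat_adjoint W"
    unfolding BX using W X by (simp only: adjm as mc mat_adjoint_carrier)
  then have "A = (W * X) * ?D' * mat_adjoint (W * X)" using AWB by simp
  then show ?case using * mc[OF W X] by blast
qed

section \<open>Positive-semidefinite matrices and their pseudoinverses\<close>

lemma dim_mat_diag [simp]: "dim_row (mat_diag n f) = n" "dim_col (mat_diag n f) = n"
  by (simp_all add: mat_diag_def)

lemma mat_diag_cong: "(\<And>i. i < n \<Longrightarrow> f i = g i) \<Longrightarrow> mat_diag n f = mat_diag n g"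
  by (rule eq_matI) (auto simp: mat_diag_def)

text \<open>The indicator \<open>J\<close> of the positive entries of \<open>L\<close> is the orthogonal projection onto the range of \<open>L\<close>.\<close>

lemma mat_diag_support:
  fixes n :: nat and l :: "nat \<Rightarrow> real"
  assumes l: "\<And>i. 0 \<le> l i"
  defines "L \<equiv> mat_diag n (\<lambda>i. complex_of_real (l i))"
    and "J \<equiv> mat_diag n (\<lambda>i. if 0 < l i then 1 else 0 :: complex)"
  shows "J * L = L" and "L * J = L"
    and "L * mat_diag n (\<lambda>i. inverse (complex_of_real (l i))) = J"
proof -
  have "(if 0 < l i then 1 else 0) * complex_of_real (l i) = complex_of_real (l i)"
    "complex_of_real (l i) * (if 0 < l i then 1 else 0) = complex_of_real (l i)"
    "complex_of_real (l i) * inverse (complex_of_real (l i)) = (if 0 < l i then 1 else 0)" for i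
    using l[of i] by auto
  then show "J * L = L" "L * J = L"
    "L * mat_diag n (\<lambda>i. inverse (complex_of_real (l i))) = J"
    unfolding J_def L_def mat_diag_diag by (simp_all only:)
qed

lemma mat_diag_mult_vec:
  fixes u :: "'a :: semiring_0 vec"
  assumes u: "u \<in> carrier_vec n"
  shows "mat_diag n f *\<^sub>v u = vec n (\<lambda>i. f i * u $ i)"
proof (rule eq_vecI)
  fix i assume i: "i < dim_vec (vec n (\<lambda>i. f i * u $ i))"
  then have "(mat_diag n f *\<^sub>v u) $ i = (\<Sum>j<n. (if i = j then f j else 0) * u $ j)"
    using u by (simp add: mat_diag_def scalar_prod_def atLeast0LessThan)
  also have "\<dots> = (\<Sum>j<n. if i = j then f j * u $ j else 0)" by (intro sum.cong) auto
  also have "\<dots> = f i * u $ i" using i by simp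
  finally show "(mat_diag n f *\<^sub>v u) $ i = vec n (\<lambda>i. f i * u $ i) $ i" using i by simp
qed (simp add: mat_diag_def)

lemma mult_carrier_square:
  "X \<in> carrier_mat n n \<Longrightarrow> Y \<in> carrier_mat n n \<Longrightarrow> X * Y \<in> carrier_mat n n"
  by (rule mult_carrier_mat)

lemma psd_mat_congruence:
  assumes A: "psd_mat n A" and X: "X \<in> carrier_mat n n"
  shows "psd_mat n (X * A * mat_adjoint X)"
proof -
  have Ac: "A \<in> carrier_mat n n" and herm: "mat_adjoint A = A"
    and pos: "\<And>x. x \<in> carrier_vec n \<Longrightarrow> 0 \<le> (A *\<^sub>v x) \<bullet>c x"
    using A by (auto simp: psd_mat_def)
  have "mat_adjoint (X * A * mat_adjoint X) = X * (A * mat_adjoint X)"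
    using Ac X herm by (simp add: mat_adjoint_mult[of _ n n _ n] mult_carrier_square[of _ n])
  moreover have "0 \<le> ((X * A * mat_adjoint X) *\<^sub>v x) \<bullet>c x" if x: "x \<in> carrier_vec n" for x
  proof -
    let ?y = "mat_adjoint X *\<^sub>v x"
    have y: "?y \<in> carrier_vec n" using X x by (intro mult_mat_vec_carrier[of _ n n]) auto
    have "(X * A * mat_adjoint X) *\<^sub>v x = X *\<^sub>v (A *\<^sub>v ?y)"
      using X Ac x y by (simp add: assoc_mult_mat_vec[of _ n n _ n] mult_carrier_square[of _ n])
    then have "((X * A * mat_adjoint X) *\<^sub>v x) \<bullet>c x = (A *\<^sub>v ?y) \<bullet>c ?y"
      using X Ac x y by (simp add: mult_mat_vec_cscalar[of X n n])
    then show ?thesis using pos[OF y] by simp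
  qed
  ultimately show ?thesis using X Ac unfolding psd_mat_def
    by (auto simp: assoc_mult_mat[of _ n n _ n _ n] mult_carrier_square[of _ n])
qed

lemma psd_unitary_diagonalization:
  assumes A: "psd_mat n A"
  shows "\<exists>U l. U \<in> carrier_mat n n \<and> mat_adjoint U * U = 1\<^sub>m n \<and> (\<forall>i. 0 \<le> l i)
    \<and> A = U * mat_diag n (\<lambda>i. complex_of_real (l i)) * mat_adjoint U"
proof -
  have Ac: "A \<in> carrier_mat n n" and herm: "mat_adjoint A = A" using A by (auto simp: psd_mat_def)
  obtain U l where U: "U \<in> carrier_mat n n" "mat_adjoint U * U = 1\<^sub>m n"
    and AU: "A = U * mat_diag n (\<lambda>i. complex_of_real (l i)) * mat_adjoint U"
    using hermitian_unitary_diagonalization[OF Ac herm] by blast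
  let ?D = "mat_diag n (\<lambda>i. complex_of_real (l i))"
  have D: "?D \<in> carrier_mat n n" by simp
  have "mat_adjoint U * A * U = (mat_adjoint U * U) * ?D * (mat_adjoint U * U)"
    unfolding AU using U(1) D by (simp add: assoc_mult_mat[of _ n n _ n _ n] mult_carrier_square[of _ n])
  also have "\<dots> = ?D" unfolding U(2) using D by (simp add: left_mult_one_mat[OF D] right_mult_one_mat[OF D])
  finally have UAU: "mat_adjoint U * A * U = ?D" .
  have "psd_mat n (mat_adjoint U * A * mat_adjoint (mat_adjoint U))"
    using psd_mat_congruence[OF A] U(1) by blast
  then have psd: "psd_mat n ?D" by (simp add: UAU)
  have nonneg: "0 \<le> l i" if i: "i < n" for i
  proof -
    have "(?D *\<^sub>v unit_vec n i) \<bullet>c unit_vec n i = complex_of_real (l i)"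
      using i by (simp add: scalar_prod_def mat_diag_def if_distrib[where f = "\<lambda>x. x * _"]
          if_distrib[where f = cnj] if_distrib[where f = "\<lambda>x. _ * x"] unit_vec_def cong: if_cong)
    moreover have "0 \<le> (?D *\<^sub>v unit_vec n i) \<bullet>c unit_vec n i"
      using psd i by (auto simp: psd_mat_def)
    ultimately show ?thesis by (simp add: less_eq_complex_def)
  qed
  \<comment> \<open>Entries of \<open>l\<close> beyond \<open>n\<close> are arbitrary; setting them to zero makes nonnegativity unconditional.\<close>
  define l' where "l' i = (if i < n then l i else 0)" for i
  have "?D = mat_diag n (\<lambda>i. complex_of_real (l' i))" by (rule mat_diag_cong) (simp add: l'_def)
  then show ?thesis using U AU nonneg by (intro exI[of _ U] exI[of _ l']) (auto simp: l'_def)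
qed

lemma unitary_sandwich_mult:
  fixes U :: "complex mat"
  assumes U: "U \<in> carrier_mat n n" and UU: "mat_adjoint U * U = 1\<^sub>m n"
  shows "(U * mat_diag n f * mat_adjoint U) * (U * mat_diag n g * mat_adjoint U)
    = U * mat_diag n (\<lambda>i. f i * g i) * mat_adjoint U"
proof -
  have D: "mat_diag n h \<in> carrier_mat n n" for h :: "nat \<Rightarrow> complex" by simp
  have "(U * mat_diag n f * mat_adjoint U) * (U * mat_diag n g * mat_adjoint U)
    = U * (mat_diag n f * ((mat_adjoint U * U) * (mat_diag n g * mat_adjoint U)))"
    using U by (simp add: assoc_mult_mat[of _ n n _ n _ n] mult_carrier_square[of _ n] del: mat_diag_diag)
  also have "\<dots> = U * (mat_diag n f * (mat_diag n g * mat_adjoint U))"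
    unfolding UU using U by (simp add: left_mult_one_mat[of _ n n] mult_carrier_square[of _ n] del: mat_diag_diag)
  also have "\<dots> = U * ((mat_diag n f * mat_diag n g) * mat_adjoint U)"
    using U by (simp add: assoc_mult_mat[of _ n n _ n _ n] mult_carrier_square[of _ n] del: mat_diag_diag)
  finally show ?thesis using U D by (simp add: assoc_mult_mat[of _ n n _ n _ n] mult_carrier_square[of _ n])
qed

lemma unitary_sandwich_adjoint:
  fixes U :: "complex mat"
  assumes U: "U \<in> carrier_mat n n"
  shows "mat_adjoint (U * mat_diag n f * mat_adjoint U)
    = U * mat_diag n (\<lambda>i. cnj (f i)) * mat_adjoint U"
  using U by (simp add: mat_adjoint_mult[of _ n n _ n] assoc_mult_mat[of _ n n _ n _ n] mult_carrier_square[of _ n])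

text \<open>The convention \<open>inverse 0 = 0\<close> makes the entrywise inverse the pseudoinverse of a diagonal matrix.\<close>

lemma pinv_unitary_sandwich:
  fixes U :: "complex mat"
  assumes U: "U \<in> carrier_mat n n" and UU: "mat_adjoint U * U = 1\<^sub>m n"
  shows "is_pinv (U * mat_diag n f * mat_adjoint U) (U * mat_diag n (\<lambda>i. inverse (f i)) * mat_adjoint U)"
proof -
  note S = unitary_sandwich_mult[OF U UU] unitary_sandwich_adjoint[OF U]
  have "(\<lambda>i. f i * inverse (f i) * f i) = f" "(\<lambda>i. inverse (f i) * f i * inverse (f i)) = (\<lambda>i. inverse (f i))"
    "(\<lambda>i. cnj (f i * inverse (f i))) = (\<lambda>i. f i * inverse (f i))"
    "(\<lambda>i. cnj (inverse (f i) * f i)) = (\<lambda>i. inverse (f i) * f i)"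
    by (rule ext; case_tac "f i = 0"; simp)+
  then show ?thesis using U unfolding is_pinv_def S
    by (simp add: mult_carrier_square[of _ n])
qed

lemma is_pinv_pinv_psd:
  assumes "psd_mat n A"
  shows "is_pinv A (pinv A)"
  using psd_unitary_diagonalization[OF assms] pinv_unitary_sandwich pinv_eqI by metis

lemma col_space_subset_imp_factor:
  fixes A B :: "'a :: field mat"
  assumes A: "A \<in> carrier_mat n m" and B: "B \<in> carrier_mat n k"
    and sub: "vec_space.col_space n A \<subseteq> vec_space.col_space n B"
  shows "\<exists>X \<in> carrier_mat k m. A = B * X"
proof -
  interpret vec_space "TYPE('a)" n .
  have "\<exists>x \<in> carrier_vec k. B *\<^sub>v x = col A j" if j: "j < m" for j
  proof -
    have "A *\<^sub>v unit_vec m j = col A j"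
      by (rule eq_vecI) (use A j in auto)
    then have "col A j \<in> col_space A"
      unfolding col_space_eq[OF A] using A j by auto
    then have "col A j \<in> col_space B" using sub by auto
    then show ?thesis unfolding col_space_eq[OF B] using B by auto
  qed
  then obtain x where x: "\<And>j. j < m \<Longrightarrow> x j \<in> carrier_vec k \<and> B *\<^sub>v x j = col A j" by metis
  define X where "X = mat_of_cols k (map x [0..<m])"
  have X: "X \<in> carrier_mat k m"
    using mat_of_cols_carrier(1)[of k "map x [0..<m]"] by (simp add: X_def)
  have colX: "col X j = x j" if "j < m" for j
    using x[OF that] that by (simp add: X_def)
  have "A = B * X"
  proof (rule eq_matI)
    fix i j assume "i < dim_row (B * X)" "j < dim_col (B * X)"
    then have ij: "i < n" "j < m" using B X by auto
    have "A $$ (i, j) = col A j $ i" using A ij by simp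
    also have "\<dots> = (B *\<^sub>v col X j) $ i" using x ij colX by simp
    also have "\<dots> = (B * X) $$ (i, j)" using B X ij by simp
    finally show "A $$ (i, j) = (B * X) $$ (i, j)" .
  qed (use A B X in auto)
  then show ?thesis using X by blast
qed

section \<open>Simultaneous diagonalisation of the matrix and its preconditioner\<close>

text \<open>A basis \<open>V\<close> in which both matrices become diagonal: \<open>A\<close> becomes \<open>diag l\<close>, and the preconditioner
  becomes the indicator of the positive entries of \<open>l\<close>. Write \<open>Ah = E P E\<^sup>*\<close> with \<open>E\<close> invertible and
  \<open>P\<close> a diagonal projection, diagonalise the positive-semidefinite matrix \<open>B = E\<^sup>-\<^sup>1 A E\<^sup>-\<^sup>*\<close> by
  a unitary \<open>U\<close>, and take \<open>V = E U\<close> with inverse \<open>W\<close>. Equality of the ranges is what forces \<open>U\<^sup>* P U\<close>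
  to be the indicator of the positive entries of \<open>l\<close>.

  A congruence does not in general carry pseudoinverses to pseudoinverses. Here it does, because \<open>E\<close> is a
  unitary matrix times a diagonal one, so that \<open>E P E\<^sup>-\<^sup>1\<close> is Hermitian: it is the orthogonal projection
  onto the common range, and so it also equals \<open>A A\<^sup>+\<close>.\<close>

lemma psd_pair_simultaneous_diagonalization:
  fixes A Ah :: "complex mat"
  assumes A: "psd_mat n A" and Ah: "psd_mat n Ah"
    and range: "vec_space.col_space n A = vec_space.col_space n Ah"
  shows "\<exists>V W l. V \<in> carrier_mat n n \<and> W \<in> carrier_mat n n \<and> W * V = 1\<^sub>m n \<and> (\<forall>i. 0 \<le> l i)
    \<and> A = V * mat_diag n (\<lambda>i. complex_of_real (l i)) * mat_adjoint V
    \<and> pinv Ah = mat_adjoint W * mat_diag n (\<lambda>i. if 0 < l i then 1 else 0) * W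
    \<and> A * pinv A = V * mat_diag n (\<lambda>i. if 0 < l i then 1 else 0) * W"
proof -
  note as = assoc_mult_mat[of _ n n _ n _ n]
  note mc = mult_carrier_square[of _ n] mat_adjoint_carrier[of _ n n] mat_diag_dim one_carrier_mat
  note adjm = mat_adjoint_mult[of _ n n _ n]
  have Ac: "A \<in> carrier_mat n n" and Ahc: "Ah \<in> carrier_mat n n"
    and Aherm: "mat_adjoint A = A" using A Ah by (auto simp: psd_mat_def)
  obtain Q \<delta> where Q: "Q \<in> carrier_mat n n" and QQ: "mat_adjoint Q * Q = 1\<^sub>m n"
    and \<delta>: "\<And>i. 0 \<le> \<delta> i"
    and AhQ: "Ah = Q * mat_diag n (\<lambda>i. complex_of_real (\<delta> i)) * mat_adjoint Q"
    using psd_unitary_diagonalization[OF Ah] by blast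
  \<comment> \<open>The value \<open>1\<close> on the kernel of \<open>Ah\<close> is arbitrary; it only has to keep \<open>E\<close> invertible.\<close>
  define e where "e i = (if \<delta> i > 0 then sqrt (\<delta> i) else 1)" for i
  have e: "e i > 0" for i by (simp add: e_def)
  define p where "p i = (if \<delta> i > 0 then 1 else 0 :: complex)" for i
  have e\<delta>: "complex_of_real (e i) * p i * complex_of_real (e i) = complex_of_real (\<delta> i)" for i
    using \<delta>[of i] by (simp add: e_def p_def flip: of_real_mult)
  have e\<delta>': "complex_of_real (1 / e i) * p i * complex_of_real (1 / e i) = inverse (complex_of_real (\<delta> i))" for i
  proof (cases "\<delta> i > 0")
    case True
    then have "1 / e i * (1 / e i) = inverse (\<delta> i)" by (simp add: e_def field_simps)
    then have "complex_of_real (1 / e i * (1 / e i)) = complex_of_real (inverse (\<delta> i))"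
      by (simp only:)
    then show ?thesis using True by (simp only: of_real_mult of_real_inverse p_def) simp
  next
    case False
    then have "\<delta> i = 0" using \<delta>[of i] by simp
    then show ?thesis by (simp add: p_def)
  qed
  define De where "De = mat_diag n (\<lambda>i. complex_of_real (e i))"
  define Df where "Df = mat_diag n (\<lambda>i. complex_of_real (1 / e i))"
  define P where "P = mat_diag n p"
  have Dc: "De \<in> carrier_mat n n" "Df \<in> carrier_mat n n" and P: "P \<in> carrier_mat n n"
    by (simp_all add: De_def Df_def P_def)
  have Dadj: "mat_adjoint De = De" "mat_adjoint Df = Df" and Padj: "mat_adjoint P = P"
    by (auto simp: De_def Df_def P_def p_def intro!: mat_diag_cong)
  have DfDe: "Df * De = 1\<^sub>m n"
    unfolding De_def Df_def mat_diag_diag using e less_imp_neq[OF e]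
    by (subst mat_diag_one[symmetric], intro mat_diag_cong) (simp flip: of_real_mult)
  have PP: "P * P = P"
    unfolding P_def mat_diag_diag by (intro mat_diag_cong) (simp add: p_def)
  have PDf: "P * Df = Df * P"
    unfolding P_def Df_def mat_diag_diag by (intro mat_diag_cong) (simp add: mult.commute)
  define E where "E = Q * De"
  define F where "F = Df * mat_adjoint Q"
  have E: "E \<in> carrier_mat n n" and F: "F \<in> carrier_mat n n"
    using Q Dc by (auto simp: E_def F_def intro!: mc)
  have FE: "F * E = 1\<^sub>m n"
  proof -
    have "F * E = Df * ((mat_adjoint Q * Q) * De)"
      unfolding E_def F_def using Q Dc by (simp only: as mc)
    then show ?thesis unfolding QQ using Dc DfDe by (simp add: left_mult_one_mat[OF Dc(1)])
  qed
  have EF: "E * F = 1\<^sub>m n" using mat_mult_left_right_inverse[OF F E FE] .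
  have EFadj: "mat_adjoint F * mat_adjoint E = 1\<^sub>m n" "mat_adjoint E * mat_adjoint F = 1\<^sub>m n"
    using arg_cong[OF EF, of mat_adjoint] arg_cong[OF FE, of mat_adjoint] E F by (simp_all add: adjm)
  have cancel: "E * (F * X) = X" "F * (E * X) = X"
    "mat_adjoint F * (mat_adjoint E * X) = X" "mat_adjoint E * (mat_adjoint F * X) = X"
    if X: "X \<in> carrier_mat n n" for X
  proof -
    have "(E * F) * X = X" "(F * E) * X = X" "(mat_adjoint F * mat_adjoint E) * X = X"
      "(mat_adjoint E * mat_adjoint F) * X = X"
      unfolding EF FE EFadj using X by (auto simp: left_mult_one_mat[OF X])
    then show "E * (F * X) = X" "F * (E * X) = X"
      "mat_adjoint F * (mat_adjoint E * X) = X" "mat_adjoint E * (mat_adjoint F * X) = X"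
      using E F X by (simp_all only: as mc)
  qed
  have AhE: "Ah = E * (P * mat_adjoint E)"
  proof -
    have "E * (P * mat_adjoint E) = Q * (De * P * De) * mat_adjoint Q"
      unfolding E_def using Q Dc P by (simp only: as mc adjm Dadj)
    also have "De * P * De = mat_diag n (\<lambda>i. complex_of_real (\<delta> i))"
      unfolding De_def P_def mat_diag_diag e\<delta> ..
    finally show ?thesis using AhQ by simp
  qed
  have pinvAh: "pinv Ah = mat_adjoint F * (P * F)"
  proof -
    have "mat_adjoint F * (P * F) = Q * (Df * P * Df) * mat_adjoint Q"
      unfolding F_def using Q Dc P by (simp only: as mc adjm Dadj mat_adjoint_involution)
    also have "Df * P * Df = mat_diag n (\<lambda>i. inverse (complex_of_real (\<delta> i)))"
      unfolding Df_def P_def mat_diag_diag e\<delta>' ..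
    finally show ?thesis
      unfolding AhQ using pinv_eqI[OF pinv_unitary_sandwich[OF Q QQ]] by simp
  qed
  define Pr where "Pr = E * (P * F)"
  have Pr: "Pr \<in> carrier_mat n n" using E P F by (auto simp: Pr_def intro!: mc)
  have Pradj: "mat_adjoint Pr = Pr"
  proof -
    have "Df * De = De * Df" unfolding Df_def De_def mat_diag_diag by (simp add: mult.commute)
    have "Pr = Q * (De * (P * Df)) * mat_adjoint Q"
      unfolding Pr_def E_def F_def using Q Dc P by (simp only: as mc)
    also have "De * (P * Df) = P"
    proof -
      have "De * (P * Df) = (De * Df) * P" using Dc P PDf by (simp only: as mc)
      also have "\<dots> = P" unfolding \<open>Df * De = De * Df\<close>[symmetric] DfDe by (rule left_mult_one_mat[OF P])
      finally show ?thesis .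
    qed
    finally have "Pr = Q * (P * mat_adjoint Q)" using Q P by (simp only: as mc)
    then show ?thesis using Q P by (simp only: as mc adjm Padj mat_adjoint_involution)
  qed
  obtain X where X: "X \<in> carrier_mat n n" and AX: "A = Ah * X"
    using col_space_subset_imp_factor[OF Ac Ahc] range by blast
  obtain Y where Y: "Y \<in> carrier_mat n n" and AY: "Ah = A * Y"
    using col_space_subset_imp_factor[OF Ahc Ac] range by blast
  have PPX: "P * (P * Z) = P * Z" if "Z \<in> carrier_mat n n" for Z
    using as[OF P P that] PP by simp
  have PrA: "Pr * A = A"
  proof -
    have "Pr * A = E * (P * (F * (E * (P * (mat_adjoint E * X)))))"
      unfolding AX AhE Pr_def using E P F X by (simp only: as mc)
    also have "\<dots> = E * (P * (mat_adjoint E * X))" using E P X by (simp only: cancel PPX mc)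
    also have "\<dots> = A" unfolding AX AhE using E P X by (simp only: as mc)
    finally show ?thesis .
  qed
  define B where "B = F * A * mat_adjoint F"
  have B: "B \<in> carrier_mat n n" using F Ac by (auto simp: B_def intro!: mc)
  have "psd_mat n B" unfolding B_def using psd_mat_congruence[OF A F] .
  then obtain U l where U: "U \<in> carrier_mat n n" and UU: "mat_adjoint U * U = 1\<^sub>m n"
    and l: "\<And>i. 0 \<le> l i"
    and BU: "B = U * mat_diag n (\<lambda>i. complex_of_real (l i)) * mat_adjoint U"
    using psd_unitary_diagonalization by blast
  have UU': "U * mat_adjoint U = 1\<^sub>m n"
    using mat_mult_left_right_inverse[OF _ U UU] U by (simp add: mc)
  have Ucancel: "U * (mat_adjoint U * Z) = Z" "mat_adjoint U * (U * Z) = Z" if Z: "Z \<in> carrier_mat n n" for Z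
    using as[OF U mat_adjoint_carrier[OF U] Z] as[OF mat_adjoint_carrier[OF U] U Z]
    unfolding UU UU' by (simp_all add: left_mult_one_mat[OF Z])
  define L where "L = mat_diag n (\<lambda>i. complex_of_real (l i))"
  define L' where "L' = mat_diag n (\<lambda>i. inverse (complex_of_real (l i)))"
  define J where "J = mat_diag n (\<lambda>i. if 0 < l i then 1 else 0 :: complex)"
  have L: "L \<in> carrier_mat n n" "L' \<in> carrier_mat n n" and J: "J \<in> carrier_mat n n"
    by (simp_all add: L_def L'_def J_def)
  have BL: "B = U * (L * mat_adjoint U)" using BU U L by (simp only: L_def[symmetric] as mc)
  have JL: "J * L = L" and LL': "L * L' = J"
    unfolding J_def L_def L'_def using l by (rule mat_diag_support)+
  have Jadj: "mat_adjoint J = J"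
    unfolding J_def mat_adjoint_mat_diag by (intro mat_diag_cong) simp
  define P' where "P' = mat_adjoint U * (P * U)"
  have P': "P' \<in> carrier_mat n n" using U P by (auto simp: P'_def intro!: mc)
  have P'adj: "mat_adjoint P' = P'"
    unfolding P'_def using U P by (simp only: adjm mc Padj mat_adjoint_involution as)
  have AE: "A = E * (B * mat_adjoint E)"
    unfolding B_def using E F Ac by (simp only: as mc cancel)  (simp add: EFadj right_mult_one_mat[OF Ac])
  \<comment> \<open>The range of \<open>A\<close> lies in that of \<open>Ah\<close>, so \<open>P\<close> acts as the identity on the range of \<open>B\<close>.\<close>
  have PB: "P * B = B"
  proof -
    have "P * B = F * (E * (P * (F * (A * mat_adjoint F))))"
      unfolding B_def using E F Ac P by (simp only: as mc cancel)
    also have "\<dots> = F * ((Pr * A) * mat_adjoint F)"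
      unfolding Pr_def using E F Ac P by (simp only: as mc)
    also have "\<dots> = B" unfolding PrA B_def using F Ac by (simp only: as mc)
    finally show ?thesis .
  qed
  have P'L: "P' * L = L"
  proof -
    have "P' * L = mat_adjoint U * ((P * B) * U)"
      unfolding P'_def BL using U P L UU by (simp only: as mc) (simp add: right_mult_one_mat[OF L(1)])
    also have "\<dots> = L" unfolding PB unfolding BL using U L UU
      by (simp only: as mc Ucancel) (simp add: right_mult_one_mat[OF L(1)])
    finally show ?thesis .
  qed
  have P'J: "P' * J = J"
    using as[OF P' L(1) L(2)] unfolding P'L LL' by simp
  \<comment> \<open>The range of \<open>Ah\<close> lies in that of \<open>A\<close>, so the range of \<open>P\<close> lies in that of \<open>B\<close>.\<close>
  have JP': "J * P' = P'"
  proof -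
    define Z where "Z = mat_adjoint U * (mat_adjoint E * (Y * (mat_adjoint F * U)))"
    have Z: "Z \<in> carrier_mat n n" using U E F Y by (auto simp: Z_def intro!: mc)
    have "P = F * (Ah * mat_adjoint F)"
      unfolding AhE using E F P by (simp only: as mc cancel) (simp add: EFadj right_mult_one_mat[OF P])
    also have "\<dots> = B * (mat_adjoint E * (Y * mat_adjoint F))"
      unfolding AY AE using E F B Y by (simp only: as mc cancel)
    finally have "P = B * (mat_adjoint E * (Y * mat_adjoint F))" .
    then have "P' = L * Z"
      unfolding P'_def Z_def BL using U L E F Y by (simp only: as mc Ucancel)
    then show ?thesis using as[OF J L(1) Z] JL by simp
  qed
  have "P' = J"
  proof -
    have "mat_adjoint (J * P') = P'" unfolding JP' P'adj ..
    then have "P' * J = P'" using J P' by (simp add: adjm Jadj P'adj)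
    then show ?thesis using P'J by simp
  qed
  then have PJ: "P = U * (J * mat_adjoint U)"
    unfolding P'_def using U P UU'
    by (auto simp: as mc Ucancel right_mult_one_mat[OF P])
  define V where "V = E * U"
  define W where "W = mat_adjoint U * F"
  have V: "V \<in> carrier_mat n n" and W: "W \<in> carrier_mat n n"
    using E U F by (auto simp: V_def W_def intro!: mc)
  have "W * V = 1\<^sub>m n"
    unfolding V_def W_def using E U F UU by (simp only: as mc cancel)
  moreover have "A = V * L * mat_adjoint V"
    unfolding AE BL V_def using E U L by (simp only: as mc adjm)
  moreover have "pinv Ah = mat_adjoint W * J * W"
    unfolding pinvAh PJ W_def using F U J by (simp only: as mc adjm mat_adjoint_involution)
  moreover have VJW: "V * J * W = Pr"
    unfolding Pr_def PJ V_def W_def using E F U J by (simp only: as mc)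
  moreover have "A * pinv A = Pr"
  proof -
    \<comment> \<open>Two Hermitian projections with the same range coincide.\<close>
    define G where "G = A * pinv A"
    have pA: "is_pinv A (pinv A)" using is_pinv_pinv_psd[OF A] .
    then have pc: "pinv A \<in> carrier_mat n n" and Gadj: "mat_adjoint G = G" and GA: "G * A = A"
      using Ac by (auto simp: is_pinv_def G_def)
    have G: "G \<in> carrier_mat n n" using Ac pc by (auto simp: G_def intro!: mc)
    have "Pr * G = G" unfolding G_def using as[OF Pr Ac pc] PrA by simp
    then have "mat_adjoint (Pr * G) = G" using Gadj by simp
    then have 1: "G * Pr = G" using Pr G by (simp add: adjm Pradj Gadj)
    define T where "T = Y * (mat_adjoint F * F)"
    have T: "T \<in> carrier_mat n n" using Y F by (auto simp: T_def intro!: mc)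
    have "Pr = Ah * (mat_adjoint F * F)"
      unfolding Pr_def AhE using E F P by (simp only: as mc cancel)
    then have PrT: "Pr = A * T" unfolding AY T_def using Ac Y F by (simp only: as mc)
    have "G * Pr = Pr" unfolding PrT using as[OF G Ac T] GA by simp
    with 1 show ?thesis by (simp add: G_def)
  qed
  ultimately show ?thesis using V W l unfolding L_def J_def
    by (intro exI[of _ V] exI[of _ W] exI[of _ l]) simp
qed

section \<open>The Kaporin condition number in terms of eigenvalues\<close>

lemma col_space_mult_subset:
  fixes M N :: "'a :: field mat"
  assumes M: "M \<in> carrier_mat n k" and N: "N \<in> carrier_mat k m"
  shows "vec_space.col_space n (M * N) \<subseteq> vec_space.col_space n M"
proof -
  interpret vec_space "TYPE('a)" n .
  have MN: "M * N \<in> carrier_mat n m" using M N by auto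
  have "(M * N) *\<^sub>v x = M *\<^sub>v (N *\<^sub>v x)" "N *\<^sub>v x \<in> carrier_vec k" if "x \<in> carrier_vec m" for x
    using M N that by (auto simp: assoc_mult_mat_vec[of _ n k _ m])
  then show ?thesis
    unfolding col_space_eq[OF M] col_space_eq[OF MN] using M N MN by auto
qed

lemma rank_eq_if_col_space_eq:
  fixes M N :: "'a :: field mat"
  assumes "vec_space.col_space n M = vec_space.col_space n N"
  shows "vec_space.rank n M = vec_space.rank n N"
proof -
  interpret vec_space "TYPE('a)" n .
  show ?thesis using assms by (simp add: rank_def col_space_def)
qed

lemma rank_mult_diag_indicator:
  fixes V W :: "'a :: field mat"
  assumes V: "V \<in> carrier_mat n n" and W: "W \<in> carrier_mat n n" and WV: "W * V = 1\<^sub>m n"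
  shows "vec_space.rank n (V * mat_diag n (\<lambda>i. if Q i then 1 else 0)) = card {i. i < n \<and> Q i}"
proof -
  interpret vec_space "TYPE('a)" n .
  let ?M = "V * mat_diag n (\<lambda>i. if Q i then 1 else 0)"
  let ?I = "{i. i < n \<and> Q i}"
  have M: "?M \<in> carrier_mat n n" using V by auto
  have colM: "col ?M j = (if Q j then col V j else 0\<^sub>v n)" if "j < n" for j
    using V that by (intro eq_vecI) (auto simp: mat_diag_mult_right[OF V])
  have "det W * det V = 1" using det_mult[OF W V] WV by simp
  then have "det V \<noteq> 0" by auto
  then have rank: "rank V = n" using low_rank_det_zero V by blast
  then have dist: "distinct (cols V)" using non_distinct_low_rank[OF V] by auto
  have indpt: "lin_indpt (set (cols V))" using full_rank_lin_indpt[OF V rank dist] .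
  define S where "S = col V ` ?I"
  have SV: "S \<subseteq> set (cols V)" using V by (auto simp: S_def cols_def)
  have indptS: "lin_indpt S" using indpt SV supset_ld_is_ld by blast
  have inj: "inj_on (col V) ?I"
  proof (rule inj_onI)
    fix i j assume "i \<in> ?I" "j \<in> ?I" "col V i = col V j"
    then show "i = j" using dist V by (auto simp: distinct_conv_nth cols_def)
  qed
  have "rank ?M = card S"
  proof (rule rank_card_indpt[OF M])
    have sub: "S \<subseteq> set (cols ?M)"
    proof
      fix x assume "x \<in> S"
      then obtain i where "i < n" "Q i" "x = col V i" by (auto simp: S_def)
      then have "x = col ?M i" "i < dim_col ?M" using colM M by auto
      then show "x \<in> set (cols ?M)" by (auto simp: cols_def)
    qed
    moreover have "T = S" if ST: "S \<subseteq> T" and TM: "T \<subseteq> set (cols ?M)" and T: "lin_indpt T" for T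
    proof
      have "T \<subseteq> carrier_vec n" using TM V cols_dim[of ?M] by auto
      moreover have "(UNIV :: 'a set) \<noteq> {0}" using one_neq_zero by blast
      ultimately have "0\<^sub>v n \<notin> T" using T zero_nin_lin_indpt[of T] by auto
      show "T \<subseteq> S"
      proof
        fix x assume x: "x \<in> T"
        then obtain i where i: "i < n" "x = col ?M i" using TM M by (auto simp: cols_def)
        then have "Q i" using colM[of i] \<open>0\<^sub>v n \<notin> T\<close> x by (auto split: if_splits)
        then show "x \<in> S" using i colM[of i] by (auto simp: S_def)
      qed
    qed (use ST in auto)
    ultimately show "maximal S (\<lambda>T. T \<subseteq> set (cols ?M) \<and> lin_indpt T)"
      using indptS by (auto simp: maximal_def)
  qed
  then show ?thesis using inj by (simp add: S_def card_image)
qed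

text \<open>The rank depends on the column space only, and the column space of \<open>V diag(l) V\<^sup>*\<close> is spanned by the
  columns of the invertible matrix \<open>V\<close> that belong to positive entries of \<open>l\<close>.\<close>

lemma rank_congruence_diag:
  fixes l :: "nat \<Rightarrow> real"
  assumes V: "V \<in> carrier_mat n n" and W: "W \<in> carrier_mat n n" and WV: "W * V = 1\<^sub>m n"
    and l: "\<And>i. 0 \<le> l i"
  shows "vec_space.rank n (V * mat_diag n (\<lambda>i. complex_of_real (l i)) * mat_adjoint V)
    = card {i. i < n \<and> 0 < l i}"
proof -
  note as = assoc_mult_mat[of _ n n _ n _ n]
  note mc = mult_carrier_square[of _ n] mat_adjoint_carrier[of _ n n]
  define L where "L = mat_diag n (\<lambda>i. complex_of_real (l i))"
  define L' where "L' = mat_diag n (\<lambda>i. inverse (complex_of_real (l i)))"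
  define J where "J = mat_diag n (\<lambda>i. if 0 < l i then 1 else 0 :: complex)"
  have c: "L \<in> carrier_mat n n" "L' \<in> carrier_mat n n" "J \<in> carrier_mat n n"
    by (simp_all add: L_def L'_def J_def)
  have JL: "J * L = L" and LL': "L * L' = J"
    unfolding J_def L_def L'_def using l by (rule mat_diag_support)+
  have VW: "mat_adjoint V * mat_adjoint W = 1\<^sub>m n"
    using arg_cong[OF WV, of mat_adjoint] mat_adjoint_mult[OF W V] by simp
  let ?A = "V * L * mat_adjoint V"
  have Ac: "?A \<in> carrier_mat n n" using V c by (auto intro!: mc)
  have "?A = (V * J) * (L * mat_adjoint V)"
    using V c as[OF c(3) c(1) mat_adjoint_carrier[OF V]] by (simp add: as mc JL)
  then have 1: "vec_space.col_space n ?A \<subseteq> vec_space.col_space n (V * J)"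
    using col_space_mult_subset[of "V * J" n n "L * mat_adjoint V" n] V c by (auto simp: mc)
  have "?A * (mat_adjoint W * L') = V * (L * ((mat_adjoint V * mat_adjoint W) * L'))"
    using V W c by (simp only: as mc)
  also have "\<dots> = V * J" unfolding VW using c LL' by (simp add: left_mult_one_mat[of _ n n])
  finally have 2: "vec_space.col_space n (V * J) \<subseteq> vec_space.col_space n ?A"
    using col_space_mult_subset[OF Ac, of "mat_adjoint W * L'" n] W c by (auto simp: mc)
  have "vec_space.rank n ?A = vec_space.rank n (V * J)"
    using 1 2 by (intro rank_eq_if_col_space_eq) auto
  then show ?thesis unfolding L_def J_def rank_mult_diag_indicator[OF V W WV] .
qed

lemma mat_trace_mult_commute:
  fixes M N :: "'a :: comm_semiring_0 mat"
  assumes "M \<in> carrier_mat n m" "N \<in> carrier_mat m n"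
  shows "mat_trace (M * N) = mat_trace (N * M)"
proof -
  have "mat_trace (M * N) = (\<Sum>i<n. \<Sum>j<m. M $$ (i, j) * N $$ (j, i))"
    using assms by (simp add: mat_trace_def scalar_prod_def atLeast0LessThan)
  also have "\<dots> = (\<Sum>j<m. \<Sum>i<n. N $$ (j, i) * M $$ (i, j))"
    by (subst sum.swap) (simp add: mult.commute)
  also have "\<dots> = mat_trace (N * M)"
    using assms by (simp add: mat_trace_def scalar_prod_def atLeast0LessThan)
  finally show ?thesis .
qed

lemma order_prod_linear_factors:
  fixes f :: "nat \<Rightarrow> 'a :: idom"
  shows "order a (\<Prod>i<n. [:- f i, 1:]) = card {i. i < n \<and> f i = a}"
proof (induction n)
  case (Suc n)
  have "(\<Prod>i<n. [:- f i, 1:]) * [:- f n, 1:] \<noteq> 0" by (simp only: mult_eq_0_iff prod_zero_iff) auto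
  then have "order a (\<Prod>i<Suc n. [:- f i, 1:]) = card {i. i < n \<and> f i = a} + order a [:- f n, 1:]"
    unfolding prod.lessThan_Suc by (subst order_mult) (auto simp: Suc.IH)
  also have "order a [:- f n, 1:] = (if f n = a then 1 else 0)"
    using order_power_n_n[of a 1] by (auto intro: order_0I)
  also have "card {i. i < n \<and> f i = a} + (if f n = a then 1 else 0) = card {i. i < Suc n \<and> f i = a}"
  proof -
    have "{i. i < Suc n \<and> f i = a} = (if f n = a then insert n {i. i < n \<and> f i = a} else {i. i < n \<and> f i = a})"
      by (auto simp: less_Suc_eq)
    then show ?thesis by simp
  qed
  finally show ?case .
qed simp

lemma mat_vol_similar_diag:
  fixes l :: "nat \<Rightarrow> real"
  assumes V: "V \<in> carrier_mat n n" and W: "W \<in> carrier_mat n n" and WV: "W * V = 1\<^sub>m n"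
  shows "mat_vol (V * mat_diag n (\<lambda>i. complex_of_real (l i)) * W) = (\<Prod>i | i < n \<and> 0 < l i. l i)"
proof -
  let ?L = "mat_diag n (\<lambda>i. complex_of_real (l i))"
  let ?M = "V * ?L * W"
  let ?I = "{i. i < n \<and> 0 < l i}"
  have M: "?M \<in> carrier_mat n n" using V W by auto
  have "V * W = 1\<^sub>m n" using mat_mult_left_right_inverse[OF W V WV] .
  then have "similar_mat ?M ?L"
    using V W WV M by (intro similar_matI[of _ _ V W n]) auto
  then have "char_poly ?M = char_poly ?L" by (rule char_poly_similar)
  also have "\<dots> = (\<Prod>a\<leftarrow>diag_mat ?L. [:- a, 1:])"
    by (rule char_poly_upper_triangular[of _ n]) (auto simp: mat_diag_def upper_triangular_def)
  also have "diag_mat ?L = map (\<lambda>i. complex_of_real (l i)) [0..<n]"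
    by (auto simp: diag_mat_def mat_diag_def)
  also have "(\<Prod>a\<leftarrow>\<dots>. [:- a, 1:]) = (\<Prod>i<n. [:- complex_of_real (l i), 1:])"
    by (simp add: prod.distinct_set_conv_list[symmetric] atLeast0LessThan comp_def)
  finally have cp: "char_poly ?M = (\<Prod>i<n. [:- complex_of_real (l i), 1:])" .
  have ev: "eigenvalue ?M (complex_of_real x) \<longleftrightarrow> x \<in> l ` {..<n}" for x
    unfolding eigenvalue_root_char_poly[OF M] cp by (auto simp: poly_prod prod_zero_iff)
  have ord: "order (complex_of_real x) (char_poly ?M) = card {i. i < n \<and> l i = x}" for x
    unfolding cp order_prod_linear_factors by simp
  have "{x. 0 < x \<and> eigenvalue ?M (complex_of_real x)} = l ` ?I"
    unfolding ev by auto
  then have "mat_vol ?M = (\<Prod>x\<in>l ` ?I. x ^ card {i. i < n \<and> l i = x})"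
    by (simp add: mat_vol_def ord)
  also have "\<dots> = (\<Prod>x\<in>l ` ?I. prod l {i \<in> ?I. l i = x})"
  proof (rule prod.cong[OF refl])
    fix x assume "x \<in> l ` ?I"
    then have "{i \<in> ?I. l i = x} = {i. i < n \<and> l i = x}" by auto
    then show "x ^ card {i. i < n \<and> l i = x} = prod l {i \<in> ?I. l i = x}" by simp
  qed
  also have "\<dots> = prod l ?I" by (rule prod.image_gen[symmetric]) simp
  finally show ?thesis .
qed

text \<open>Since \<open>A Ah\<^sup>+ = V diag(l) V\<^sup>-\<^sup>1\<close>, trace, volume and rank in the Kaporin condition number are the sum, the
  product and the number of the positive \<open>l i\<close>. The witness \<open>c\<close> is their arithmetic mean, for which
  the linear parts of the defects sum to zero.\<close>

lemma ln_kaporin_eq_defect_sum: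
  fixes l :: "nat \<Rightarrow> real"
  assumes V: "V \<in> carrier_mat n n" and W: "W \<in> carrier_mat n n" and WV: "W * V = 1\<^sub>m n"
    and l: "\<And>i. 0 \<le> l i"
    and A: "A = V * mat_diag n (\<lambda>i. complex_of_real (l i)) * mat_adjoint V"
    and pAh: "pinv Ah = mat_adjoint W * mat_diag n (\<lambda>i. if 0 < l i then 1 else 0) * W"
    and range: "vec_space.col_space n A = vec_space.col_space n Ah"
    and ne: "i0 < n" "0 < l i0"
  shows "\<exists>c > 0. ln_ext (kaporin A Ah) = ereal (\<Sum>i | i < n \<and> 0 < l i. kaporin_defect (l i / c))"
proof -
  note as = assoc_mult_mat[of _ n n _ n _ n]
  note mc = mult_carrier_square[of _ n] mat_adjoint_carrier[of _ n n]
  let ?I = "{i. i < n \<and> 0 < l i}"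
  define r where "r = card ?I"
  define L where "L = mat_diag n (\<lambda>i. complex_of_real (l i))"
  define J where "J = mat_diag n (\<lambda>i. if 0 < l i then 1 else 0 :: complex)"
  have c: "L \<in> carrier_mat n n" "J \<in> carrier_mat n n" by (simp_all add: L_def J_def)
  have dimA: "dim_row A = n" using A V by simp
  have LJ: "L * J = L" unfolding J_def L_def using l by (rule mat_diag_support)
  have VW: "mat_adjoint V * mat_adjoint W = 1\<^sub>m n"
    using arg_cong[OF WV, of mat_adjoint] mat_adjoint_mult[OF W V] by simp
  have "A * pinv Ah = V * (L * ((mat_adjoint V * mat_adjoint W) * (J * W)))"
    unfolding A pAh L_def[symmetric] J_def[symmetric] using V W c by (simp only: as mc)
  also have "\<dots> = V * ((L * J) * W)"
    unfolding VW using c W by (simp add: left_mult_one_mat[of _ n n] mc as)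
  finally have AA: "A * pinv Ah = V * L * W" unfolding LJ using V W c by (simp only: as mc)
  have "mat_trace (A * pinv Ah) = mat_trace (W * (V * L))"
    unfolding AA using V W c by (intro mat_trace_mult_commute[of _ n n]) (auto simp: mc)
  also have "W * (V * L) = L" using as[OF W V c(1)] c by (simp add: WV left_mult_one_mat[of _ n n])
  also have "mat_trace L = (\<Sum>i<n. complex_of_real (l i))"
    by (simp add: mat_trace_def L_def mat_diag_def)
  finally have "Re (mat_trace (A * pinv Ah)) = (\<Sum>i<n. l i)" by simp
  also have "\<dots> = sum l ?I"
    using l by (intro sum.mono_neutral_right) (auto simp: antisym_conv2)
  finally have tr: "Re (mat_trace (A * pinv Ah)) = sum l ?I" .
  have vol: "mat_vol (A * pinv Ah) = prod l ?I"
    unfolding AA L_def using mat_vol_similar_diag[OF V W WV] .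
  have rank: "vec_space.rank n A = r"
    unfolding A r_def using rank_congruence_diag[OF V W WV l] .
  have r: "r > 0" using ne by (auto simp: r_def card_gt_0_iff)
  have sum_pos: "sum l ?I > 0" using ne l by (intro sum_pos2[of _ i0]) auto
  define m where "m = sum l ?I / real r"
  have m: "m > 0" using sum_pos r by (simp add: m_def)
  have prod_pos: "prod l ?I > 0" by (intro prod_pos) auto
  have "kaporin A Ah = ereal (m ^ r / prod l ?I)"
    using range by (simp add: kaporin_def Let_def dimA rank tr vol m_def)
  then have "ln_ext (kaporin A Ah) = ereal (ln (m ^ r / prod l ?I))"
    by (simp add: ln_ext_def)
  also have "ln (m ^ r / prod l ?I) = real r * ln m - (\<Sum>i\<in>?I. ln (l i))"
  proof -
    have "ln (prod l ?I) = (\<Sum>i\<in>?I. ln (l i))" by (rule ln_prod) auto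
    then show ?thesis using m prod_pos by (simp add: ln_div ln_realpow)
  qed
  also have "\<dots> = (\<Sum>i\<in>?I. kaporin_defect (l i / m))"
  proof -
    have "(\<Sum>i\<in>?I. kaporin_defect (l i / m)) = (\<Sum>i\<in>?I. l i / m - 1 - (ln (l i) - ln m))"
      using m by (intro sum.cong) (auto simp: kaporin_defect_def ln_div)
    also have "\<dots> = sum l ?I / m - real r - ((\<Sum>i\<in>?I. ln (l i)) - real r * ln m)"
      by (simp add: sum_subtractf sum_divide_distrib r_def)
    also have "sum l ?I / m = real r" using sum_pos r by (simp add: m_def)
    finally show ?thesis by simp
  qed
  finally show ?thesis using m by blast
qed

section \<open>Preconditioned conjugate gradient in eigenvector coordinates\<close>

text \<open>In coordinates \<open>W r\<close> for residuals and \<open>V\<^sup>* d\<close> for directions, \<open>A\<close> acts as \<open>diag l\<close>, the preconditioner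
  as the indicator of the positive \<open>l i\<close>, and the Euclidean pairing of a direction with a residual is
  unchanged. So preconditioned conjugate gradient is the plain method for a diagonal matrix, which
  multiplies the initial residual by polynomials in the eigenvalues. Nothing is claimed about the residual
  at indices with \<open>l i = 0\<close>: these hold the part of \<open>b\<close> outside the range of \<open>A\<close>, which the
  preconditioner annihilates.\<close>

lemma pcg_state_diagonal_coordinates:
  fixes A Ah V W :: "complex mat" and l :: "nat \<Rightarrow> real"
  assumes V: "V \<in> carrier_mat n n" and W: "W \<in> carrier_mat n n" and WV: "W * V = 1\<^sub>m n"
    and A: "A = V * mat_diag n (\<lambda>i. complex_of_real (l i)) * mat_adjoint V"
    and pAh: "pinv Ah = mat_adjoint W * mat_diag n (\<lambda>i. if 0 < l i then 1 else 0) * W"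
    and b: "b \<in> carrier_vec n" and x0: "x0 \<in> carrier_vec n"
  defines "s0 \<equiv> W *\<^sub>v (b - A *\<^sub>v x0)"
  defines "I \<equiv> {i. i < n \<and> 0 < l i}"
  defines "w \<equiv> \<lambda>i. (cmod (s0 $ i))\<^sup>2"
  assumes state: "pcg_state A Ah b x0 t = (x, r, d)" and polys: "cg_polys I w l t = (R, D)"
  shows "x \<in> carrier_vec n" and "r = b - A *\<^sub>v x"
    and "\<And>i. i \<in> I \<Longrightarrow> (W *\<^sub>v r) $ i = complex_of_real (poly R (l i)) * s0 $ i"
    and "d = mat_adjoint W *\<^sub>v vec n (\<lambda>i. if 0 < l i then complex_of_real (poly D (l i)) * s0 $ i else 0)"
proof -
  let ?ip = "nodal_ip I w l"
  define L where "L = mat_diag n (\<lambda>i. complex_of_real (l i))"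
  \<comment> \<open>\<open>P s\<close> is the vector whose coordinates are \<open>s\<close> cut off to the positive eigenvalues.\<close>
  define P where "P s = mat_adjoint W *\<^sub>v vec n (\<lambda>i. if 0 < l i then s i else 0)" for s :: "nat \<Rightarrow> complex"
  have Lc: "L \<in> carrier_mat n n" by (simp add: L_def)
  have Ac: "A \<in> carrier_mat n n" using V by (simp add: A mult_carrier_square[of _ n])
  have cut: "vec n (\<lambda>i. if 0 < l i then s i else 0) \<in> carrier_vec n" for s :: "nat \<Rightarrow> complex" by simp
  have Pc: "P s \<in> carrier_vec n" for s using W cut unfolding P_def by (intro mult_mat_vec_carrier[of _ n n]) auto
  have s0c: "s0 \<in> carrier_vec n"
    using W Ac b x0 unfolding s0_def by (intro mult_mat_vec_carrier[of _ n n]) auto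
  have VW: "mat_adjoint V * mat_adjoint W = 1\<^sub>m n"
    using arg_cong[OF WV, of mat_adjoint] mat_adjoint_mult[OF W V] by simp
  have VP: "mat_adjoint V *\<^sub>v P s = vec n (\<lambda>i. if 0 < l i then s i else 0)" for s
  proof -
    have "mat_adjoint V *\<^sub>v P s = (mat_adjoint V * mat_adjoint W) *\<^sub>v vec n (\<lambda>i. if 0 < l i then s i else 0)"
      unfolding P_def using V W by (intro assoc_mult_mat_vec[symmetric, of _ n n _ n]) auto
    then show ?thesis unfolding VW by simp
  qed
  have pAh_vec: "pinv Ah *\<^sub>v r = P (\<lambda>i. (W *\<^sub>v r) $ i)" if r: "r \<in> carrier_vec n" for r
  proof -
    let ?J = "mat_diag n (\<lambda>i. if 0 < l i then 1 else 0 :: complex)"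
    have Wr: "W *\<^sub>v r \<in> carrier_vec n" using W r by (intro mult_mat_vec_carrier[of _ n n])
    have "pinv Ah *\<^sub>v r = mat_adjoint W *\<^sub>v (?J *\<^sub>v (W *\<^sub>v r))"
      unfolding pAh using W r Wr by (simp add: assoc_mult_mat_vec[of _ n n _ n] mult_carrier_square[of _ n])
    also have "?J *\<^sub>v (W *\<^sub>v r) = vec n (\<lambda>i. if 0 < l i then (W *\<^sub>v r) $ i else 0)"
      unfolding mat_diag_mult_vec[OF Wr] by (intro eq_vecI) auto
    finally show ?thesis by (simp add: P_def)
  qed
  have A_vec: "A *\<^sub>v y = V *\<^sub>v (L *\<^sub>v (mat_adjoint V *\<^sub>v y))" if "y \<in> carrier_vec n" for y
  proof -
    have "mat_adjoint V *\<^sub>v y \<in> carrier_vec n" using V that by (intro mult_mat_vec_carrier[of _ n n]) auto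
    then show ?thesis unfolding A L_def[symmetric] using V Lc that
      by (simp add: assoc_mult_mat_vec[of _ n n _ n] mult_carrier_square[of _ n])
  qed
  have WA_P: "W *\<^sub>v (A *\<^sub>v P s) = vec n (\<lambda>i. if 0 < l i then complex_of_real (l i) * s i else 0)" for s
  proof -
    let ?u = "L *\<^sub>v vec n (\<lambda>i. if 0 < l i then s i else 0)"
    have u: "?u \<in> carrier_vec n" using Lc cut by (intro mult_mat_vec_carrier[of _ n n])
    have "W *\<^sub>v (A *\<^sub>v P s) = (W * V) *\<^sub>v ?u"
      unfolding A_vec[OF Pc] VP using V W u by (simp add: assoc_mult_mat_vec[of _ n n _ n])
    also have "\<dots> = ?u" unfolding WV using u by simp
    also have "\<dots> = vec n (\<lambda>i. if 0 < l i then complex_of_real (l i) * s i else 0)"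
      unfolding L_def mat_diag_mult_vec[OF cut] by (intro eq_vecI) auto
    finally show ?thesis .
  qed
  have P_ip: "P s \<bullet>c r = (\<Sum>i\<in>I. s i * cnj ((W *\<^sub>v r) $ i))" if r: "r \<in> carrier_vec n" for s r
  proof -
    have Wr: "W *\<^sub>v r \<in> carrier_vec n" using W r by (intro mult_mat_vec_carrier[of _ n n])
    have "P s \<bullet>c r = vec n (\<lambda>i. if 0 < l i then s i else 0) \<bullet>c (W *\<^sub>v r)"
      unfolding P_def using W r cut by (subst mult_mat_vec_cscalar[of _ n n]) auto
    also have "\<dots> = (\<Sum>i<n. (if 0 < l i then s i else 0) * cnj ((W *\<^sub>v r) $ i))"
      using Wr W by (auto simp: scalar_prod_def atLeast0LessThan intro!: sum.cong)
    also have "\<dots> = (\<Sum>i\<in>I. s i * cnj ((W *\<^sub>v r) $ i))"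
      unfolding I_def by (intro sum.mono_neutral_cong_right) auto
    finally show ?thesis .
  qed
  have AP_ip: "(A *\<^sub>v P s) \<bullet>c P s = (\<Sum>i\<in>I. complex_of_real (l i) * s i * cnj (s i))" for s
  proof -
    have Ac': "A *\<^sub>v P s \<in> carrier_vec n" using Ac Pc by (intro mult_mat_vec_carrier[of _ n n])
    have "(A *\<^sub>v P s) \<bullet>c P s = (W *\<^sub>v (A *\<^sub>v P s)) \<bullet>c vec n (\<lambda>i. if 0 < l i then s i else 0)"
      unfolding P_def[of s] using Ac' W cut
      by (subst mult_mat_vec_cscalar[of W n n]) (auto simp: P_def)
    also have "\<dots> = (\<Sum>i<n. (if 0 < l i then complex_of_real (l i) * s i else 0) * cnj (if 0 < l i then s i else 0))"
      unfolding WA_P by (auto simp: scalar_prod_def atLeast0LessThan intro!: sum.cong)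
    also have "\<dots> = (\<Sum>i\<in>I. complex_of_real (l i) * s i * cnj (s i))"
      unfolding I_def by (intro sum.mono_neutral_cong_right) auto
    finally show ?thesis .
  qed
  have w_sq: "complex_of_real (w i) = s0 $ i * cnj (s0 $ i)" for i
    unfolding w_def by (rule complex_norm_square)
  have mult_zero: "M *\<^sub>v 0\<^sub>v n = 0\<^sub>v n" if "M \<in> carrier_mat n n" for M :: "complex mat"
    by (rule eq_vecI) (use that in auto)
  have P_zero: "P s = 0\<^sub>v n \<longleftrightarrow> (\<forall>i\<in>I. s i = 0)" for s
  proof
    assume "P s = 0\<^sub>v n"
    then have "vec n (\<lambda>i. if 0 < l i then s i else 0) = 0\<^sub>v n"
      using VP[of s] mult_zero[of "mat_adjoint V"] V by simp
    then show "\<forall>i\<in>I. s i = 0" by (auto simp: I_def vec_eq_iff)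
  next
    assume "\<forall>i\<in>I. s i = 0"
    then have "vec n (\<lambda>i. if 0 < l i then s i else 0) = 0\<^sub>v n" by (intro eq_vecI) (auto simp: I_def)
    then show "P s = 0\<^sub>v n" using W by (simp add: P_def mult_zero)
  qed
  define matches where "matches R D x r d \<longleftrightarrow> x \<in> carrier_vec n \<and> r = b - A *\<^sub>v x \<and>
    (\<forall>i\<in>I. (W *\<^sub>v r) $ i = complex_of_real (poly R (l i)) * s0 $ i) \<and>
    d = P (\<lambda>i. complex_of_real (poly D (l i)) * s0 $ i)" for R D x r d
  have "matches R D x r d"
    using state polys
  proof (induction t arbitrary: x r d R D)
    case 0
    have rc: "b - A *\<^sub>v x0 \<in> carrier_vec n" using b x0 Ac by auto
    show ?case using 0 x0 pAh_vec[OF rc] by (auto simp: matches_def Let_def s0_def)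
  next
    case (Suc t x2 r2 d2 R2 D2)
    obtain x r d where st: "pcg_state A Ah b x0 t = (x, r, d)" by (metis prod_cases3)
    obtain R D where pl: "cg_polys I w l t = (R, D)" by fastforce
    have IH: "matches R D x r d" by (rule Suc.IH[OF st pl])
    have x: "x \<in> carrier_vec n" and r: "r = b - A *\<^sub>v x"
      and Wr: "\<And>i. i \<in> I \<Longrightarrow> (W *\<^sub>v r) $ i = complex_of_real (poly R (l i)) * s0 $ i"
      and d: "d = P (\<lambda>i. complex_of_real (poly D (l i)) * s0 $ i)"
      using IH by (auto simp: matches_def)
    have rc: "r \<in> carrier_vec n" using r b x Ac by auto
    have dc: "d \<in> carrier_vec n" using Pc d by simp
    have zr_gen: "(pinv Ah *\<^sub>v r) \<bullet>c r = complex_of_real (?ip R R)"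
      if rc: "r \<in> carrier_vec n"
        and Wr: "\<And>i. i \<in> I \<Longrightarrow> (W *\<^sub>v r) $ i = complex_of_real (poly R (l i)) * s0 $ i" for r R
    proof -
      have "(pinv Ah *\<^sub>v r) \<bullet>c r = (\<Sum>i\<in>I. (W *\<^sub>v r) $ i * cnj ((W *\<^sub>v r) $ i))"
        unfolding pAh_vec[OF rc] P_ip[OF rc] ..
      also have "\<dots> = (\<Sum>i\<in>I. complex_of_real (w i * poly R (l i) * poly R (l i)))"
        by (intro sum.cong refl) (simp add: Wr w_sq mult_ac)
      finally show ?thesis by (simp add: nodal_ip_def)
    qed
    have zr: "(pinv Ah *\<^sub>v r) \<bullet>c r = complex_of_real (?ip R R)" using rc Wr by (rule zr_gen)
    have dAd: "(A *\<^sub>v d) \<bullet>c d = complex_of_real (?ip (pCons 0 D) D)"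
    proof -
      have "(A *\<^sub>v d) \<bullet>c d = (\<Sum>i\<in>I. complex_of_real (w i * poly (pCons 0 D) (l i) * poly D (l i)))"
        unfolding d AP_ip by (intro sum.cong refl) (simp add: w_sq mult_ac)
      then show ?thesis by (simp add: nodal_ip_def)
    qed
    have stop: "pinv Ah *\<^sub>v r = 0\<^sub>v (dim_row A) \<longleftrightarrow> ?ip R R = 0"
    proof -
      have "?ip R R = 0 \<longleftrightarrow> (\<forall>i\<in>I. w i * poly R (l i) * poly R (l i) = 0)"
        unfolding nodal_ip_def
        by (rule sum_nonneg_eq_0_iff) (auto simp: I_def w_def mult.assoc)
      also have "\<dots> \<longleftrightarrow> (\<forall>i\<in>I. (W *\<^sub>v r) $ i = 0)"
        by (intro ball_cong refl) (auto simp: Wr w_def)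
      finally show ?thesis using Ac by (simp add: pAh_vec[OF rc] P_zero)
    qed
    show ?case
    proof (cases "?ip R R = 0")
      case True
      then show ?thesis using Suc.prems st pl stop IH by simp
    next
      case False
      define \<alpha> where "\<alpha> = ?ip R R / ?ip (pCons 0 D) D"
      have R2: "R2 = R - smult \<alpha> (pCons 0 D)"
        and D2: "D2 = R2 + smult (?ip R2 R2 / ?ip R R) D"
        using Suc.prems pl False by (auto simp: Let_def \<alpha>_def)
      have \<alpha>: "(pinv Ah *\<^sub>v r) \<bullet>c r / ((A *\<^sub>v d) \<bullet>c d) = complex_of_real \<alpha>"
        unfolding zr dAd \<alpha>_def by simp
      have x2: "x2 = x + complex_of_real \<alpha> \<cdot>\<^sub>v d"
        and r2: "r2 = r - complex_of_real \<alpha> \<cdot>\<^sub>v (A *\<^sub>v d)"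
        and d2: "d2 = pinv Ah *\<^sub>v r2 + ((pinv Ah *\<^sub>v r2) \<bullet>c r2 / ((pinv Ah *\<^sub>v r) \<bullet>c r)) \<cdot>\<^sub>v d"
        using Suc.prems st stop False by (auto simp: Let_def \<alpha>)
      have Ad: "A *\<^sub>v d \<in> carrier_vec n" using Ac dc by (intro mult_mat_vec_carrier[of _ n n])
      have x2c: "x2 \<in> carrier_vec n" using x dc by (simp add: x2)
      have Ax: "A *\<^sub>v x \<in> carrier_vec n" using Ac x by (intro mult_mat_vec_carrier[of _ n n])
      have "A *\<^sub>v x2 = A *\<^sub>v x + complex_of_real \<alpha> \<cdot>\<^sub>v (A *\<^sub>v d)"
        unfolding x2 using Ac x dc by (simp add: mult_add_distrib_mat_vec[of _ n n] mult_mat_vec[of _ n n])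
      then have r2': "r2 = b - A *\<^sub>v x2"
        unfolding r2 r using Ax Ad b by (intro eq_vecI) auto
      have r2c: "r2 \<in> carrier_vec n" using rc Ad by (simp add: r2)
      have WAd: "W *\<^sub>v (A *\<^sub>v d) = vec n (\<lambda>i. if 0 < l i
          then complex_of_real (l i) * (complex_of_real (poly D (l i)) * s0 $ i) else 0)"
        unfolding d WA_P ..
      have "W *\<^sub>v r2 = W *\<^sub>v r - complex_of_real \<alpha> \<cdot>\<^sub>v (W *\<^sub>v (A *\<^sub>v d))"
        unfolding r2 using W rc Ad
        by (simp add: mult_minus_distrib_mat_vec[of _ n n] mult_mat_vec[of _ n n])
      then have Wr2: "(W *\<^sub>v r2) $ i = complex_of_real (poly R2 (l i)) * s0 $ i" if "i \<in> I" for i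
        using that Wr[OF that] W by (simp add: WAd R2 I_def algebra_simps)
      have zr2: "(pinv Ah *\<^sub>v r2) \<bullet>c r2 = complex_of_real (?ip R2 R2)" using r2c Wr2 by (rule zr_gen)
      have "d2 = pinv Ah *\<^sub>v r2 + complex_of_real (?ip R2 R2 / ?ip R R) \<cdot>\<^sub>v d"
        unfolding d2 zr zr2 by simp
      also have "\<dots> = P (\<lambda>i. complex_of_real (poly D2 (l i)) * s0 $ i)"
      proof -
        let ?\<beta> = "complex_of_real (?ip R2 R2 / ?ip R R)"
        have "P (\<lambda>i. complex_of_real (poly D2 (l i)) * s0 $ i) = mat_adjoint W *\<^sub>v
          (vec n (\<lambda>i. if 0 < l i then (W *\<^sub>v r2) $ i else 0)
            + ?\<beta> \<cdot>\<^sub>v vec n (\<lambda>i. if 0 < l i then complex_of_real (poly D (l i)) * s0 $ i else 0))"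
          unfolding P_def
          by (intro arg_cong2[where f = mult_mat_vec] refl eq_vecI)
            (auto simp: Wr2 I_def D2 algebra_simps)
        also have "\<dots> = P (\<lambda>i. (W *\<^sub>v r2) $ i) + ?\<beta> \<cdot>\<^sub>v P (\<lambda>i. complex_of_real (poly D (l i)) * s0 $ i)"
          unfolding P_def using W
          by (subst mult_add_distrib_mat_vec[of _ n n]) (auto simp: mult_mat_vec[of _ n n])
        finally show ?thesis unfolding pAh_vec[OF r2c] d by simp
      qed
      finally show ?thesis using x2c r2' Wr2 by (simp add: matches_def)
    qed
  qed
  then show "x \<in> carrier_vec n" "r = b - A *\<^sub>v x"
    "\<And>i. i \<in> I \<Longrightarrow> (W *\<^sub>v r) $ i = complex_of_real (poly R (l i)) * s0 $ i"
    "d = mat_adjoint W *\<^sub>v vec n (\<lambda>i. if 0 < l i then complex_of_real (poly D (l i)) * s0 $ i else 0)"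
    by (auto simp: matches_def P_def)
qed

section \<open>The convergence bound\<close>

text \<open>On the indices with \<open>l i > 0\<close>, the coordinates of \<open>A (x - x\<^sub>\<star>)\<close> are minus those of the residual, because
  \<open>A x\<^sub>\<star> = A A\<^sup>+ b\<close> differs from \<open>b\<close> only in the kernel coordinates. Dividing by \<open>l i\<close> recovers the
  coordinates of the error.\<close>

lemma energy_norm_diagonal_coordinates:
  fixes A V W :: "complex mat" and l :: "nat \<Rightarrow> real"
  assumes V: "V \<in> carrier_mat n n" and W: "W \<in> carrier_mat n n" and WV: "W * V = 1\<^sub>m n"
    and l: "\<And>i. 0 \<le> l i"
    and A: "A = V * mat_diag n (\<lambda>i. complex_of_real (l i)) * mat_adjoint V"
    and ApA: "A * pinv A = V * mat_diag n (\<lambda>i. if 0 < l i then 1 else 0) * W"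
    and psd: "psd_mat n A"
    and b: "b \<in> carrier_vec n" and x: "x \<in> carrier_vec n"
  shows "(energy_norm A (x - pinv A *\<^sub>v b))\<^sup>2
    = (\<Sum>i | i < n \<and> 0 < l i. (cmod ((W *\<^sub>v (b - A *\<^sub>v x)) $ i))\<^sup>2 / l i)"
proof -
  let ?I = "{i. i < n \<and> 0 < l i}"
  let ?L = "mat_diag n (\<lambda>i. complex_of_real (l i))"
  let ?J = "mat_diag n (\<lambda>i. if 0 < l i then 1 else 0 :: complex)"
  note mv = mult_mat_vec_carrier[of _ n n]
  have Ac: "A \<in> carrier_mat n n" using psd by (simp add: psd_mat_def)
  have pc: "pinv A \<in> carrier_mat n n" using is_pinv_pinv_psd[OF psd] Ac by (auto simp: is_pinv_def)
  define xs where "xs = pinv A *\<^sub>v b"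
  have xs: "xs \<in> carrier_vec n" unfolding xs_def using pc b by (rule mv)
  define e where "e = x - xs"
  have e: "e \<in> carrier_vec n" using x xs by (simp add: e_def)
  define y where "y = mat_adjoint V *\<^sub>v e"
  have y: "y \<in> carrier_vec n" unfolding y_def using V e by (intro mv) auto
  have Ly: "?L *\<^sub>v y = vec n (\<lambda>i. complex_of_real (l i) * y $ i)"
    by (rule mat_diag_mult_vec[OF y])
  have Lyc: "?L *\<^sub>v y \<in> carrier_vec n" using y by (intro mv) auto
  have Ae: "A *\<^sub>v e = V *\<^sub>v (?L *\<^sub>v y)"
    unfolding A y_def using V e y[unfolded y_def]
    by (simp add: assoc_mult_mat_vec[of _ n n _ n] mult_carrier_square[of _ n])
  have "(A *\<^sub>v e) \<bullet>c e = (?L *\<^sub>v y) \<bullet>c y"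
    unfolding Ae using V Lyc e by (simp add: mult_mat_vec_cscalar[of _ n n] y_def)
  also have "\<dots> = complex_of_real (\<Sum>i<n. l i * (cmod (y $ i))\<^sup>2)"
    unfolding Ly using y by (auto simp: scalar_prod_def atLeast0LessThan complex_norm_square mult_ac
        simp del: of_real_power intro!: sum.cong)
  finally have energy: "(A *\<^sub>v e) \<bullet>c e = complex_of_real (\<Sum>i<n. l i * (cmod (y $ i))\<^sup>2)" .
  have "(energy_norm A e)\<^sup>2 = (\<Sum>i<n. l i * (cmod (y $ i))\<^sup>2)"
    unfolding energy_norm_def energy using l by (simp add: sum_nonneg)
  also have "\<dots> = (\<Sum>i\<in>?I. l i * (cmod (y $ i))\<^sup>2)"
    using l by (intro sum.mono_neutral_right) (auto simp: less_le)
  also have "\<dots> = (\<Sum>i\<in>?I. (cmod ((W *\<^sub>v (b - A *\<^sub>v x)) $ i))\<^sup>2 / l i)"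
  proof (rule sum.cong[OF refl])
    fix i assume "i \<in> ?I"
    then have i: "i < n" "0 < l i" by auto
    have WAe: "W *\<^sub>v (A *\<^sub>v e) = ?L *\<^sub>v y"
    proof -
      have "W *\<^sub>v (A *\<^sub>v e) = (W * V) *\<^sub>v (?L *\<^sub>v y)"
        unfolding Ae using V W Lyc by (simp add: assoc_mult_mat_vec[of _ n n _ n])
      then show ?thesis unfolding WV using Lyc by simp
    qed
    have Ax: "A *\<^sub>v x \<in> carrier_vec n" using Ac x by (rule mv)
    have Wb: "W *\<^sub>v b \<in> carrier_vec n" using W b by (rule mv)
    have JWb: "?J *\<^sub>v (W *\<^sub>v b) = vec n (\<lambda>i. (if 0 < l i then 1 else 0) * (W *\<^sub>v b) $ i)"
      by (rule mat_diag_mult_vec[OF Wb])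
    have Axs: "A *\<^sub>v xs = V *\<^sub>v (?J *\<^sub>v (W *\<^sub>v b))"
    proof -
      have "A *\<^sub>v xs = (A * pinv A) *\<^sub>v b"
        unfolding xs_def using Ac pc b by (simp add: assoc_mult_mat_vec[of _ n n _ n])
      then show ?thesis unfolding ApA using V W b Wb
        by (simp add: assoc_mult_mat_vec[of _ n n _ n] mult_carrier_square[of _ n])
    qed
    have Jc: "?J *\<^sub>v (W *\<^sub>v b) \<in> carrier_vec n" by (rule mv[OF mat_diag_dim Wb])
    have "W *\<^sub>v (A *\<^sub>v xs) = (W * V) *\<^sub>v (?J *\<^sub>v (W *\<^sub>v b))"
      unfolding Axs using V W Jc by (simp add: assoc_mult_mat_vec[of _ n n _ n])
    then have WAxs: "W *\<^sub>v (A *\<^sub>v xs) = ?J *\<^sub>v (W *\<^sub>v b)" unfolding WV using Jc by simp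
    have Axsc: "A *\<^sub>v xs \<in> carrier_vec n" using Ac xs by (rule mv)
    have "W *\<^sub>v (A *\<^sub>v e) = W *\<^sub>v (A *\<^sub>v x) - ?J *\<^sub>v (W *\<^sub>v b)"
      unfolding e_def using Ac W x xs Ax Axsc
      by (simp add: mult_minus_distrib_mat_vec[of _ n n] WAxs)
    moreover have "W *\<^sub>v (b - A *\<^sub>v x) = W *\<^sub>v b - W *\<^sub>v (A *\<^sub>v x)"
      using W b Ax by (simp add: mult_minus_distrib_mat_vec[of _ n n])
    ultimately have "(?L *\<^sub>v y) $ i = - (W *\<^sub>v (b - A *\<^sub>v x)) $ i"
      using i W unfolding WAe[symmetric] by (simp add: JWb)
    then have "complex_of_real (l i) * y $ i = - (W *\<^sub>v (b - A *\<^sub>v x)) $ i"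
      using i by (simp add: Ly)
    then have "cmod (complex_of_real (l i) * y $ i) = cmod ((W *\<^sub>v (b - A *\<^sub>v x)) $ i)"
      by (simp only: norm_minus_cancel)
    then have "cmod ((W *\<^sub>v (b - A *\<^sub>v x)) $ i) = l i * cmod (y $ i)"
      using i by (simp add: norm_mult)
    then show "l i * (cmod (y $ i))\<^sup>2 = (cmod ((W *\<^sub>v (b - A *\<^sub>v x)) $ i))\<^sup>2 / l i"
      using i by (simp add: power2_eq_square)
  qed
  finally show ?thesis by (simp add: e_def xs_def)
qed

theorem proposition3p3:
  fixes n t :: nat
    and A Ah :: "complex mat"
    and b x0 xs :: "complex vec"
  assumes "psd_mat n A" and "psd_mat n Ah"
    and "b \<in> carrier_vec n" and "x0 \<in> carrier_vec n"
    and "xs = pinv A *\<^sub>v b"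
    and "energy_norm A (x0 - xs) \<noteq> 0"
  shows "ereal ((energy_norm A (pcg_iterate A Ah b x0 t - xs))\<^sup>2 / (energy_norm A (x0 - xs))\<^sup>2)
    \<le> (if t = 0 then 1 else (3 * ln_ext (kaporin A Ah) / ereal (real t)) ^ t)"
proof (cases "t = 0")
  case True
  then show ?thesis using assms(6) by (simp add: pcg_iterate_def Let_def)
next
  case t: False
  show ?thesis
  proof (cases "vec_space.col_space n A = vec_space.col_space n Ah")
    case False
    have "dim_row A = n" using assms(1) by (auto simp: psd_mat_def)
    then have "ln_ext (kaporin A Ah) = \<infinity>" using False by (simp add: kaporin_def ln_ext_def)
    then show ?thesis using t by simp
  next
    case range: True
    obtain V W l where V: "V \<in> carrier_mat n n" and W: "W \<in> carrier_mat n n" and WV: "W * V = 1\<^sub>m n"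
      and l: "\<And>i. 0 \<le> l i"
      and A: "A = V * mat_diag n (\<lambda>i. complex_of_real (l i)) * mat_adjoint V"
      and pAh: "pinv Ah = mat_adjoint W * mat_diag n (\<lambda>i. if 0 < l i then 1 else 0) * W"
      and ApA: "A * pinv A = V * mat_diag n (\<lambda>i. if 0 < l i then 1 else 0) * W"
      using psd_pair_simultaneous_diagonalization[OF assms(1,2) range] by blast
    define I where "I = {i. i < n \<and> 0 < l i}"
    have fin: "finite I" by (simp add: I_def)
    have lI: "l i > 0" if "i \<in> I" for i using that by (simp add: I_def)
    note energy = energy_norm_diagonal_coordinates[OF V W WV l A ApA assms(1,3), folded assms(5) I_def]
    define s0 where "s0 = W *\<^sub>v (b - A *\<^sub>v x0)"
    define w where "w i = (cmod (s0 $ i))\<^sup>2" for i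
    have E0: "(energy_norm A (x0 - xs))\<^sup>2 = (\<Sum>i\<in>I. w i / l i)"
      using energy[OF assms(4)] by (simp add: w_def s0_def)
    then have "I \<noteq> {}" using assms(6) by auto
    then obtain i0 where i0: "i0 < n" "0 < l i0" by (auto simp: I_def)
    obtain c where c: "c > 0"
      and lnk: "ln_ext (kaporin A Ah) = ereal (\<Sum>i\<in>I. kaporin_defect (l i / c))"
      using ln_kaporin_eq_defect_sum[OF V W WV l A pAh range i0] by (auto simp: I_def)
    define K where "K = (\<Sum>i\<in>I. kaporin_defect (l i / c))"
    obtain p where p: "degree p \<le> t" "poly p 0 = 1"
      and p_bound: "\<And>i. i \<in> I \<Longrightarrow> (poly p (l i))\<^sup>2 \<le> (3 * K / real t) ^ t"
      using residual_poly_linear_bound[where I = I and l = l and c = c and t = t, OF fin lI c]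
      unfolding K_def by blast
    obtain x r d where st: "pcg_state A Ah b x0 t = (x, r, d)" by (metis prod_cases3)
    obtain R D where pl: "cg_polys I w l t = (R, D)" by fastforce
    note coords = pcg_state_diagonal_coordinates[OF V W WV A pAh assms(3,4), folded s0_def I_def,
        folded w_def, OF st pl]
    have "(energy_norm A (x - xs))\<^sup>2 = (\<Sum>i\<in>I. (cmod ((W *\<^sub>v r) $ i))\<^sup>2 / l i)"
      using energy[OF coords(1)] coords(2) by simp
    also have "\<dots> = (\<Sum>i\<in>I. w i * (poly R (l i))\<^sup>2 / l i)"
      by (intro sum.cong refl) (simp add: coords(3) norm_mult power_mult_distrib w_def mult_ac)
    also have "\<dots> \<le> (\<Sum>i\<in>I. w i * (poly p (l i))\<^sup>2 / l i)"
      by (rule cg_polys_optimal[OF fin _ lI pl p]) (simp_all add: w_def)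
    also have "\<dots> \<le> (\<Sum>i\<in>I. (3 * K / real t) ^ t * (w i / l i))"
    proof (rule sum_mono)
      fix i assume i: "i \<in> I"
      have "(poly p (l i))\<^sup>2 * (w i / l i) \<le> (3 * K / real t) ^ t * (w i / l i)"
        using p_bound[OF i] lI[OF i] by (intro mult_right_mono) (auto simp: w_def)
      then show "w i * (poly p (l i))\<^sup>2 / l i \<le> (3 * K / real t) ^ t * (w i / l i)"
        by (simp add: mult.commute)
    qed
    also have "\<dots> = (3 * K / real t) ^ t * (energy_norm A (x0 - xs))\<^sup>2"
      unfolding E0 by (simp add: sum_distrib_left)
    finally have "(energy_norm A (x - xs))\<^sup>2 / (energy_norm A (x0 - xs))\<^sup>2 \<le> (3 * K / real t) ^ t"
      using assms(6) by (simp add: divide_le_eq)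
    then show ?thesis
      using t by (simp add: pcg_iterate_def st lnk K_def[symmetric] ereal_power)
  qed
qed

end
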